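(* For every $0<\gamma<1$ there is a constant $C_\gamma$, depending only on $\gamma$, such that the following holds. Let $\mathcal S$ be a $\gamma$-sparse family of intervals in $\mathbb R$ such that for any two $A,B\in\mathcal S$ either $A\subset B$ or $B\subset A$. Then for every $A_2$ weight $w$ on $\mathbb R$, $$\|\mathcal A^*_{\mathcal S}\|_{L^2(w)\to L^2(w)}\le C_\gamma\,[w]_{A_2}^{3/2}.$$
   Context: Intervals are bounded intervals of $\mathbb R$ of positive length, and $|\cdot|$ is Lebesgue measure. A weight is a positive measurable function $w$ on $\mathbb R$. It is an $A_2$ weight if $$[w]_{A_2}:=\sup_I\Big(\frac1{|I|}\int_I w\Big)\Big(\frac1{|I|}\int_I w^{-1}\Big)<\infty,$$ the supremum being over all intervals $I$. A family $\mathcal S$ of intervals is called $\gamma$-sparse ($0<\gamma<1$) if there exist pairwise disjoint measurable subsets $E_A\subset A$, $A\in\mathcal S$, with $|E_A|\ge\gamma|A|$. For an interval $B$ set $\langle f\rangle_B:=\frac1{|B|}\int_B|f|$ and $M_Bf:=\sup\{\langle f\rangle_A: A\text{ an interval},\ A\supset B\}$. The strong-sparse operator associated with a sparse family $\mathcal S$ is $$\mathcal A^*_{\mathcal S}f(x):=\sum_{A\in\mathcal S}(M_Af)\,\mathbf 1_A(x).$$ Norms: $\|f\|_{L^2(w)}=\big(\int_{\mathbb R}|f|^2w\big)^{1/2}$, and for a (sublinear) operator $T$, $\|T\|_{L^2(w)\to L^2(w)}$ is the supremum of $\|Tf\|_{L^2(w)}/\|f\|_{L^2(w)}$ over $f\in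 L^2(w)$, $f\neq0$. *)

theory Defs
  imports "HOL-Analysis.Analysis"
begin

(* Bounded intervals of positive length; open, closed and half-open ones are all allowed. *)
definition intervals :: "real set set" where
  "intervals = {A. is_interval A \<and> bounded A \<and> measure lebesgue A > 0}"

definition avg :: "(real \<Rightarrow> real) \<Rightarrow> real set \<Rightarrow> ennreal" where
  "avg f B = (\<integral>\<^sup>+x\<in>B. ennreal \<bar>f x\<bar> \<partial>lebesgue) / emeasure lebesgue B"

definition weight :: "(real \<Rightarrow> real) \<Rightarrow> bool" where
  "weight w \<longleftrightarrow> w \<in> borel_measurable lebesgue \<and> (\<forall>x. w x > 0)"

(* For a weight w both averages are nonzero, so the convention 0 * \<infinity> = 0 of ennreal plays
   no role here, and finiteness of the supremum makes w and 1/w locally integrable. *)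
definition A2_const :: "(real \<Rightarrow> real) \<Rightarrow> ennreal" where
  "A2_const w = (SUP I\<in>intervals. avg w I * avg (\<lambda>x. inverse (w x)) I)"

definition A2_weight :: "(real \<Rightarrow> real) \<Rightarrow> bool" where
  "A2_weight w \<longleftrightarrow> weight w \<and> A2_const w < \<infinity>"

definition sparse_family :: "real \<Rightarrow> real set set \<Rightarrow> bool" where
  "sparse_family \<gamma> \<S> \<longleftrightarrow> \<S> \<subseteq> intervals \<and>
     (\<exists>E. disjoint_family_on E \<S> \<and>
          (\<forall>A\<in>\<S>. E A \<in> sets lebesgue \<and> E A \<subseteq> A \<and>
                 measure lebesgue (E A) \<ge> \<gamma> * measure lebesgue A))"

definition M_avg :: "real set \<Rightarrow> (real \<Rightarrow> real) \<Rightarrow> ennreal" where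
  "M_avg B f = (SUP A\<in>{A \<in> intervals. B \<subseteq> A}. avg f A)"

(* The sum over a possibly infinite family is unconditional summation in ennreal, where
   every family is summable. *)
definition strong_sparse :: "real set set \<Rightarrow> (real \<Rightarrow> real) \<Rightarrow> real \<Rightarrow> ennreal" where
  "strong_sparse \<S> f x = (\<Sum>\<^sub>\<infinity>A\<in>\<S>. M_avg A f * indicator A x)"

(* Only used with exponents p > 0. *)
definition ennreal_power :: "ennreal \<Rightarrow> real \<Rightarrow> ennreal" where
  "ennreal_power x p = (if x = \<infinity> then \<infinity> else ennreal (enn2real x powr p))"

(* The norm takes ennreal-valued functions because strong_sparse does. A real function f
   enters through its absolute value. *)
definition L2_wnorm :: "(real \<Rightarrow> real) \<Rightarrow> (real \<Rightarrow> ennreal) \<Rightarrow> ennreal" where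
  "L2_wnorm w g = ennreal_power (\<integral>\<^sup>+x. g x ^ 2 * ennreal (w x) \<partial>lebesgue) (1/2)"

definition L2_w :: "(real \<Rightarrow> real) \<Rightarrow> (real \<Rightarrow> real) set" where
  "L2_w w = {f \<in> borel_measurable lebesgue. L2_wnorm w (\<lambda>x. ennreal \<bar>f x\<bar>) < \<infinity>}"

(* The condition f \<noteq> 0 is read in L2(w), i.e. modulo null sets: the norm of f is nonzero. *)
definition L2_opnorm :: "(real \<Rightarrow> real) \<Rightarrow> ((real \<Rightarrow> real) \<Rightarrow> real \<Rightarrow> ennreal) \<Rightarrow> ennreal" where
  "L2_opnorm w T =
     (SUP f\<in>{f \<in> L2_w w. L2_wnorm w (\<lambda>x. ennreal \<bar>f x\<bar>) \<noteq> 0}.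
        L2_wnorm w (T f) / L2_wnorm w (\<lambda>x. ennreal \<bar>f x\<bar>))"

end

theory Submission
  imports Defs
begin

text \<open>The closures of the intervals of the chain have a common point c, so up to constants
  every A of length about 2^k may be replaced by the ball B(k) of radius 2^k around c, and
  sparseness allows boundedly many A per scale. With F(m) the integral of |f| over B(m) and
  b(j) the supremum of 2^(-m) F(m) over m \<ge> j, the operator is bounded on the k-th annulus by the
  sum of b(j) over j \<ge> k. The A2 condition yields the reverse doubling w(B(k)) \<le> 4 [w] w(B(k) - B(k-1)),
  and the same for the dual weight, hence Hardy inequalities with constant of order [w].\<close>

section \<open>Summation over the integers\<close>

text \<open>The exponent 3/2 comes from an L^3 bound for the squared norm, and this rests on keeping
  both Hardy inequalities asymmetric. The one for W has annulus masses on the left and ball masses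
  on the right. The dual one for \<sigma> has reciprocal ball masses on the left and reciprocal
  annulus masses on the right. Each costs one factor of L = 4 [w], and between them the A2 condition
  exchanges the ball mass \<open>W j\<close> for at most L 4^j / \<open>\<sigma> j\<close>.
  Returning to annulus masses at this junction through reverse doubling would cost a further L each
  time. The scales run over all integers, since the chain may shrink towards c and also grow without
  bound. Sums are written as \<open>ennreal\<close>-valued integrals over
  \<open>count_space\<close>, so that orders of summation can be exchanged without any convergence
  question.\<close>

lemma nn_integral_count_space_swap:
  fixes p :: "'a \<Rightarrow> ennreal" and g :: "'b \<Rightarrow> ennreal"
  shows "(\<integral>\<^sup>+k. p k * (\<integral>\<^sup>+j\<in>S k. g j \<partial>count_space UNIV) \<partial>count_space UNIV) =
         (\<integral>\<^sup>+j. g j * (\<integral>\<^sup>+k\<in>{k. j \<in> S k}. p k \<partial>count_space UNIV) \<partial>count_space UNIV)"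
proof -
  let ?h = "\<lambda>(k, j). p k * (g j * indicator (S k) j)"
  have "(\<integral>\<^sup>+k. p k * (\<integral>\<^sup>+j\<in>S k. g j \<partial>count_space UNIV) \<partial>count_space UNIV) =
        (\<integral>\<^sup>+k. \<integral>\<^sup>+j. ?h (k, j) \<partial>count_space UNIV \<partial>count_space UNIV)"
    by (simp add: nn_integral_cmult)
  also have "\<dots> = (\<integral>\<^sup>+j. \<integral>\<^sup>+k. ?h (k, j) \<partial>count_space UNIV \<partial>count_space UNIV)"
    by (simp only: nn_integral_fst_count_space nn_integral_snd_count_space)
  also have "\<dots> = (\<integral>\<^sup>+j. \<integral>\<^sup>+k. g j * (p k * indicator {k. j \<in> S k} k)
      \<partial>count_space UNIV \<partial>count_space UNIV)"
    by (intro nn_integral_cong) (auto simp: mult_ac split: split_indicator)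
  also have "\<dots> = (\<integral>\<^sup>+j. g j * (\<integral>\<^sup>+k\<in>{k. j \<in> S k}. p k \<partial>count_space UNIV) \<partial>count_space UNIV)"
    by (simp add: nn_integral_cmult)
  finally show ?thesis .
qed

text \<open>This is Cauchy-Schwarz for 1 and g with respect to the measure p dM, obtained from the
  splitting p g = sqrt p * (sqrt p * g).\<close>

lemma weighted_Cauchy_Schwarz_nn_integral:
  fixes p :: "'a \<Rightarrow> real" and g :: "'a \<Rightarrow> ennreal"
  assumes [measurable]: "p \<in> borel_measurable M" "g \<in> borel_measurable M"
    and p: "\<And>x. 0 \<le> p x"
  shows "(\<integral>\<^sup>+x. ennreal (p x) * g x \<partial>M)\<^sup>2 \<le>
         (\<integral>\<^sup>+x. ennreal (p x) \<partial>M) * (\<integral>\<^sup>+x. ennreal (p x) * (g x)\<^sup>2 \<partial>M)"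
proof -
  have sq: "(ennreal (sqrt (p x)))\<^sup>2 = ennreal (p x)" for x
    using p by (simp add: ennreal_power)
  have sq': "ennreal (sqrt (p x)) * (ennreal (sqrt (p x)) * g x) = ennreal (p x) * g x" for x
    by (simp add: power2_eq_square mult.assoc flip: sq)
  have "(\<integral>\<^sup>+x. ennreal (sqrt (p x)) * (ennreal (sqrt (p x)) * g x) \<partial>M)\<^sup>2 \<le>
        (\<integral>\<^sup>+x. (ennreal (sqrt (p x)))\<^sup>2 \<partial>M) * (\<integral>\<^sup>+x. (ennreal (sqrt (p x)) * g x)\<^sup>2 \<partial>M)"
    by (rule Cauchy_Schwarz_nn_integral) measurable
  then show ?thesis
    by (simp add: power_mult_distrib sq sq')
qed

text \<open>The test weight p is at the disposal of the user. Cauchy-Schwarz with p inside each row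
  bounds the squared row sum by \<open>A k\<close> times a sum of b^2 / p, and exchanging the
  summations leaves the column sums of \<open>m k * A k\<close>, controlled by e. Both Hardy
  inequalities are instances with a p built from the square root of W.\<close>

lemma Schur_test_count_space:
  fixes p :: "'b \<Rightarrow> real" and m A :: "'a \<Rightarrow> ennreal" and b e :: "'b \<Rightarrow> ennreal"
  assumes p: "\<And>j. 0 < p j"
    and A: "\<And>k. (\<integral>\<^sup>+j\<in>S k. ennreal (p j) \<partial>count_space UNIV) \<le> A k"
    and e: "\<And>j. (\<integral>\<^sup>+k\<in>{k. j \<in> S k}. m k * A k \<partial>count_space UNIV) \<le> e j"
  shows "(\<integral>\<^sup>+k. m k * (\<integral>\<^sup>+j\<in>S k. b j \<partial>count_space UNIV)\<^sup>2 \<partial>count_space UNIV) \<le>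
         (\<integral>\<^sup>+j. (b j)\<^sup>2 * ennreal (1 / p j) * e j \<partial>count_space UNIV)"
proof -
  have CS: "(\<integral>\<^sup>+j\<in>S k. b j \<partial>count_space UNIV)\<^sup>2 \<le>
        A k * (\<integral>\<^sup>+j\<in>S k. (b j)\<^sup>2 * ennreal (1 / p j) \<partial>count_space UNIV)" for k
  proof -
    let ?p = "\<lambda>j. p j * indicator (S k) j" and ?g = "\<lambda>j. b j * ennreal (1 / p j)"
    have pp: "ennreal (p j) * ennreal (1 / p j) = 1" for j
      using p[of j] by (simp flip: ennreal_mult)
    have "ennreal (?p j) * ?g j = b j * indicator (S k) j" for j
      using pp[of j] by (auto simp: mult_ac split: split_indicator)
    moreover have "ennreal (?p j) * (?g j)\<^sup>2 = (b j)\<^sup>2 * ennreal (1 / p j) * indicator (S k) j" for j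
    proof -
      have "ennreal (p j) * (?g j)\<^sup>2 =
          (b j)\<^sup>2 * ennreal (1 / p j) * (ennreal (p j) * ennreal (1 / p j))"
        by (simp add: power2_eq_square mult_ac)
      then show ?thesis by (auto simp: pp split: split_indicator)
    qed
    moreover have "ennreal (?p j) = ennreal (p j) * indicator (S k) j" for j
      by (auto split: split_indicator)
    ultimately have "(\<integral>\<^sup>+j\<in>S k. b j \<partial>count_space UNIV)\<^sup>2 \<le>
        (\<integral>\<^sup>+j\<in>S k. ennreal (p j) \<partial>count_space UNIV) *
        (\<integral>\<^sup>+j\<in>S k. (b j)\<^sup>2 * ennreal (1 / p j) \<partial>count_space UNIV)"
      using weighted_Cauchy_Schwarz_nn_integral[of ?p "count_space UNIV" ?g] p
      by (simp add: less_imp_le)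
    also have "\<dots> \<le> A k * (\<integral>\<^sup>+j\<in>S k. (b j)\<^sup>2 * ennreal (1 / p j) \<partial>count_space UNIV)"
      by (intro mult_right_mono A) auto
    finally show ?thesis .
  qed
  have "(\<integral>\<^sup>+k. m k * (\<integral>\<^sup>+j\<in>S k. b j \<partial>count_space UNIV)\<^sup>2 \<partial>count_space UNIV) \<le>
      (\<integral>\<^sup>+k. m k * (A k * (\<integral>\<^sup>+j\<in>S k. (b j)\<^sup>2 * ennreal (1 / p j) \<partial>count_space UNIV))
        \<partial>count_space UNIV)"
    by (intro nn_integral_mono mult_left_mono CS) auto
  also have "\<dots> = (\<integral>\<^sup>+j. (b j)\<^sup>2 * ennreal (1 / p j) *
      (\<integral>\<^sup>+k\<in>{k. j \<in> S k}. m k * A k \<partial>count_space UNIV) \<partial>count_space UNIV)"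
    by (subst nn_integral_count_space_swap[symmetric]) (simp add: mult.assoc)
  also have "\<dots> \<le> (\<integral>\<^sup>+j. (b j)\<^sup>2 * ennreal (1 / p j) * e j \<partial>count_space UNIV)"
    by (intro nn_integral_mono mult_left_mono e) auto
  finally show ?thesis .
qed

text \<open>A discrete integral test with t as antiderivative: partial sums telescope, and
  nonnegativity of t allows the far end to be dropped without computing a limit.\<close>

lemma nn_integral_atLeast_telescope:
  fixes a t :: "int \<Rightarrow> real"
  assumes a: "\<And>k. 0 \<le> a k" "\<And>k. a k \<le> t k - t (k + 1)" and t: "\<And>k. 0 \<le> t k"
  shows "(\<integral>\<^sup>+k\<in>{j..}. ennreal (a k) \<partial>count_space UNIV) \<le> ennreal (t j)"
proof -
  have bij: "bij_betw (\<lambda>n. j + int n) UNIV {j..}"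
    by (rule bij_betwI[where g = "\<lambda>k. nat (k - j)"]) auto
  have part: "(\<Sum>n<N. a (j + int n)) \<le> t j - t (j + int N)" for N
  proof (induction N)
    case (Suc N)
    then show ?case using a(2)[of "j + int N"] by (simp add: add.assoc add.commute[of 1])
  qed simp
  have "(\<integral>\<^sup>+k\<in>{j..}. ennreal (a k) \<partial>count_space UNIV) = (\<integral>\<^sup>+k. ennreal (a k) \<partial>count_space {j..})"
    by (rule nn_integral_count_space_indicator[symmetric]) simp
  also have "\<dots> = (\<integral>\<^sup>+n. ennreal (a (j + int n)) \<partial>count_space UNIV)"
    by (rule nn_integral_bij_count_space[OF bij, symmetric])
  also have "\<dots> = (\<Sum>n. ennreal (a (j + int n)))"
    by (rule nn_integral_count_space_nat)
  also have "\<dots> = (SUP N. \<Sum>n<N. ennreal (a (j + int n)))"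
    by (rule suminf_eq_SUP)
  also have "\<dots> \<le> ennreal (t j)"
  proof (rule SUP_least)
    fix N
    have "(\<Sum>n<N. a (j + int n)) \<le> t j"
      using part[of N] t[of "j + int N"] by linarith
    then show "(\<Sum>n<N. ennreal (a (j + int n))) \<le> ennreal (t j)"
      using a(1) by (simp add: sum_ennreal ennreal_leI)
  qed
  finally show ?thesis .
qed

text \<open>The reflection k -> -k turns this into the previous lemma.\<close>

lemma nn_integral_atMost_telescope:
  fixes a t :: "int \<Rightarrow> real"
  assumes a: "\<And>k. 0 \<le> a k" "\<And>k. a k \<le> t k - t (k - 1)" and t: "\<And>k. 0 \<le> t k"
  shows "(\<integral>\<^sup>+k\<in>{..j}. ennreal (a k) \<partial>count_space UNIV) \<le> ennreal (t j)"
proof -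
  have "(\<integral>\<^sup>+k\<in>{..j}. ennreal (a k) \<partial>count_space UNIV) =
        (\<integral>\<^sup>+k. ennreal (a (- k)) * indicator {..j} (- k) \<partial>count_space UNIV)"
    by (rule nn_integral_bij_count_space[symmetric]) (simp add: bij_uminus)
  also have "\<dots> = (\<integral>\<^sup>+k\<in>{-j..}. ennreal (a (- k)) \<partial>count_space UNIV)"
    by (intro nn_integral_cong) (auto split: split_indicator)
  also have "\<dots> \<le> ennreal (t (- (- j)))"
  proof (rule nn_integral_atLeast_telescope[where t = "\<lambda>k. t (- k)"])
    show "a (- k) \<le> t (- k) - t (- (k + 1))" for k
      using a(2)[of "-k"] by simp
  qed (use a t in auto)
  finally show ?thesis by simp
qed

section \<open>Hardy inequalities under reverse doubling\<close>

text \<open>Equivalently L W(k-1) \<le> (L-1) W(k), so W decays geometrically towards the centre.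
  The form with a difference is the one that telescopes, and the difference is the mass of an
  annulus.\<close>

locale reverse_doubling =
  fixes W :: "int \<Rightarrow> real" and L :: real
  assumes pos: "\<And>k. 0 < W k" and L_pos: "0 < L"
    and growth: "\<And>k. W k \<le> L * (W k - W (k - 1))"
begin

lemma diff_pos: "0 < W k - W (k - 1)"
proof -
  have "0 < L * (W k - W (k - 1))"
    using pos[of k] growth[of k] by linarith
  then show ?thesis
    using L_pos by (simp add: zero_less_mult_iff)
qed

text \<open>Reverse doubling passes to the square root at the price of a factor 2: with a < b the
  two roots, b^2 - a^2 = (b - a)(b + a) \<le> 2b (b - a).\<close>

lemma sqrt_growth: "sqrt (W k) \<le> 2 * L * (sqrt (W k) - sqrt (W (k - 1)))"
proof -
  let ?a = "sqrt (W (k - 1))" and ?b = "sqrt (W k)"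
  have ab: "0 < ?a" "?a < ?b" using pos diff_pos[of k] by auto
  have "?b * ?b = W k" "?a * ?a = W (k - 1)" using pos[of k] pos[of "k - 1"] by auto
  then have "?b * ?b \<le> L * ((?b - ?a) * (?b + ?a))"
    using growth[of k] by (simp add: algebra_simps)
  also have "\<dots> \<le> L * ((?b - ?a) * (2 * ?b))"
    using ab L_pos by (intro mult_left_mono) auto
  finally have "?b * ?b \<le> (2 * L * (?b - ?a)) * ?b"
    by (simp add: algebra_simps)
  then show ?thesis using ab by (simp only: mult_le_cancel_right)
qed

lemma sum_inverse_sqrt_le:
  "(\<integral>\<^sup>+j\<in>{k..}. ennreal (1 / sqrt (W j)) \<partial>count_space UNIV) \<le> ennreal (2 * L / sqrt (W k))"
proof (rule nn_integral_atLeast_telescope)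
  \<comment> \<open>The growth is needed at k + 1, across the annulus outside the k-th ball: the
    difference of reciprocals has numerator sqrt (W (k+1)) - sqrt (W k), at least sqrt (W (k+1)) /
    (2L).\<close>
  show "1 / sqrt (W k) \<le> 2 * L / sqrt (W k) - 2 * L / sqrt (W (k + 1))" for k
    using sqrt_growth[of "k + 1"] pos[of k] pos[of "k + 1"]
    by (simp add: field_simps)
qed (use pos L_pos in \<open>auto simp: less_imp_le\<close>)

text \<open>The discrete form of the integral of dW / sqrt W, which is 2 sqrt W. No factor of L is
  lost here, which is why each Schur test below costs L only once.\<close>

lemma sum_diff_over_sqrt_le:
  "(\<integral>\<^sup>+k\<in>{..j}. ennreal ((W k - W (k - 1)) / sqrt (W k)) \<partial>count_space UNIV)
    \<le> ennreal (2 * sqrt (W j))"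
proof (rule nn_integral_atMost_telescope)
  show "(W k - W (k - 1)) / sqrt (W k) \<le> 2 * sqrt (W k) - 2 * sqrt (W (k - 1))" for k
  proof -
    let ?a = "sqrt (W (k - 1))" and ?b = "sqrt (W k)"
    have ab: "0 < ?a" "?a < ?b" using pos diff_pos[of k] by auto
    have "W k - W (k - 1) = (?b - ?a) * (?b + ?a)"
      using pos[of k] pos[of "k - 1"] by (simp add: algebra_simps)
    also have "\<dots> \<le> (?b - ?a) * (2 * ?b)" using ab by (intro mult_left_mono) auto
    finally have "W k - W (k - 1) \<le> (2 * ?b - 2 * ?a) * ?b" by (simp add: algebra_simps)
    then show ?thesis using ab by (simp only: pos_divide_le_eq)
  qed
qed (use pos diff_pos in \<open>auto simp: less_imp_le intro!: divide_nonneg_pos\<close>)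

text \<open>The growth condition itself says that L W is a discrete antiderivative dominating
  W.\<close>

lemma sum_atMost_le:
  "(\<integral>\<^sup>+j\<in>{..i}. ennreal (W j) \<partial>count_space UNIV) \<le> ennreal (L * W i)"
  by (rule nn_integral_atMost_telescope)
    (use pos L_pos growth in \<open>auto simp: less_imp_le algebra_simps\<close>)

text \<open>Schur test with p = W^(-1/2). Rows give 2L / sqrt W and columns then 2L * 2 sqrt W; the
  remaining 1/p = sqrt W completes 4 L W.\<close>

lemma Hardy_atLeast:
  fixes b :: "int \<Rightarrow> ennreal"
  shows "(\<integral>\<^sup>+k. ennreal (W k - W (k - 1)) * (\<integral>\<^sup>+j\<in>{k..}. b j \<partial>count_space UNIV)\<^sup>2
      \<partial>count_space UNIV) \<le> (\<integral>\<^sup>+j. (b j)\<^sup>2 * ennreal (4 * L * W j) \<partial>count_space UNIV)"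
proof -
  have "(\<integral>\<^sup>+k. ennreal (W k - W (k - 1)) * (\<integral>\<^sup>+j\<in>{k..}. b j \<partial>count_space UNIV)\<^sup>2
      \<partial>count_space UNIV) \<le> (\<integral>\<^sup>+j. (b j)\<^sup>2 * ennreal (1 / (1 / sqrt (W j))) *
        ennreal (4 * L * sqrt (W j)) \<partial>count_space UNIV)"
  proof (rule Schur_test_count_space[OF _ sum_inverse_sqrt_le])
    fix j
    have "(\<integral>\<^sup>+k\<in>{k. j \<in> {k..}}. ennreal (W k - W (k - 1)) * ennreal (2 * L / sqrt (W k))
          \<partial>count_space UNIV) =
        (\<integral>\<^sup>+k. ennreal (2 * L) * (ennreal ((W k - W (k - 1)) / sqrt (W k)) * indicator {..j} k)
          \<partial>count_space UNIV)"
      using pos diff_pos L_pos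
      by (intro nn_integral_cong)
        (auto simp: less_imp_le field_simps simp flip: ennreal_mult split: split_indicator)
    also have "\<dots> \<le> ennreal (2 * L) * ennreal (2 * sqrt (W j))"
      by (simp add: nn_integral_cmult mult_left_mono sum_diff_over_sqrt_le)
    also have "\<dots> = ennreal (4 * L * sqrt (W j))"
      using L_pos pos by (simp add: less_imp_le flip: ennreal_mult)
    finally show "(\<integral>\<^sup>+k\<in>{k. j \<in> {k..}}. ennreal (W k - W (k - 1)) * ennreal (2 * L / sqrt (W k))
          \<partial>count_space UNIV) \<le> ennreal (4 * L * sqrt (W j))" .
  qed (use pos in auto)
  also have "\<dots> = (\<integral>\<^sup>+j. (b j)\<^sup>2 * ennreal (4 * L * W j) \<partial>count_space UNIV)"
  proof (intro nn_integral_cong)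
    fix j
    have "sqrt (W j) * (4 * L * sqrt (W j)) = 4 * L * (sqrt (W j) * sqrt (W j))"
      by (simp only: mult_ac)
    then have "1 / (1 / sqrt (W j)) * (4 * L * sqrt (W j)) = 4 * L * W j"
      using pos[of j] by simp
    moreover have "ennreal (1 / (1 / sqrt (W j))) * ennreal (4 * L * sqrt (W j)) =
        ennreal (1 / (1 / sqrt (W j)) * (4 * L * sqrt (W j)))"
      using pos[of j] L_pos by (intro ennreal_mult[symmetric]) auto
    ultimately show "(b j)\<^sup>2 * ennreal (1 / (1 / sqrt (W j))) * ennreal (4 * L * sqrt (W j)) =
        (b j)\<^sup>2 * ennreal (4 * L * W j)"
      by (simp only: mult.assoc)
  qed
  finally show ?thesis .
qed

text \<open>The l2-dual of \<open>Hardy_atLeast\<close>, with the same constant. It is proved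
  directly by a Schur test with p = (W i - W (i-1)) / sqrt (W i), in which the two preceding sum
  estimates exchange the roles of row and column.\<close>

lemma Hardy_atMost:
  fixes f :: "int \<Rightarrow> ennreal"
  shows "(\<integral>\<^sup>+j. ennreal (1 / W j) * (\<integral>\<^sup>+i\<in>{..j}. f i \<partial>count_space UNIV)\<^sup>2
      \<partial>count_space UNIV) \<le> (\<integral>\<^sup>+i. (f i)\<^sup>2 * ennreal (4 * L / (W i - W (i - 1))) \<partial>count_space UNIV)"
proof -
  have "(\<integral>\<^sup>+j. ennreal (1 / W j) * (\<integral>\<^sup>+i\<in>{..j}. f i \<partial>count_space UNIV)\<^sup>2
      \<partial>count_space UNIV) \<le> (\<integral>\<^sup>+i. (f i)\<^sup>2 * ennreal (1 / ((W i - W (i - 1)) / sqrt (W i))) *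
        ennreal (4 * L / sqrt (W i)) \<partial>count_space UNIV)"
  proof (rule Schur_test_count_space[OF _ sum_diff_over_sqrt_le])
    fix i
    have "ennreal (1 / W k) * ennreal (2 * sqrt (W k)) = ennreal 2 * ennreal (1 / sqrt (W k))" for k
    proof -
      have "1 / W k * (2 * sqrt (W k)) = 2 * (1 / sqrt (W k))"
        using pos[of k] by (simp add: field_simps)
      then show ?thesis
        using pos[of k] by (subst (1 2) ennreal_mult[symmetric]) auto
    qed
    then have "(\<integral>\<^sup>+k\<in>{k. i \<in> {..k}}. ennreal (1 / W k) * ennreal (2 * sqrt (W k))
          \<partial>count_space UNIV) =
        (\<integral>\<^sup>+k. ennreal 2 * (ennreal (1 / sqrt (W k)) * indicator {i..} k) \<partial>count_space UNIV)"
      by (intro nn_integral_cong) (simp only: mult.assoc, auto split: split_indicator)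
    also have "\<dots> \<le> ennreal 2 * ennreal (2 * L / sqrt (W i))"
      by (simp add: nn_integral_cmult mult_left_mono sum_inverse_sqrt_le)
    also have "\<dots> = ennreal (4 * L / sqrt (W i))"
      using L_pos pos[of i] by (subst ennreal_mult[symmetric]) auto
    finally show "(\<integral>\<^sup>+k\<in>{k. i \<in> {..k}}. ennreal (1 / W k) * ennreal (2 * sqrt (W k))
          \<partial>count_space UNIV) \<le> ennreal (4 * L / sqrt (W i))" .
  qed (use pos diff_pos in auto)
  also have "\<dots> = (\<integral>\<^sup>+i. (f i)\<^sup>2 * ennreal (4 * L / (W i - W (i - 1))) \<partial>count_space UNIV)"
  proof (intro nn_integral_cong)
    fix i
    let ?d = "W i - W (i - 1)"
    have "1 / (?d / sqrt (W i)) * (4 * L / sqrt (W i)) = 4 * L / ?d"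
      using pos[of i] by simp
    moreover have "ennreal (1 / (?d / sqrt (W i))) * ennreal (4 * L / sqrt (W i)) =
        ennreal (1 / (?d / sqrt (W i)) * (4 * L / sqrt (W i)))"
      using pos[of i] L_pos diff_pos[of i] by (intro ennreal_mult[symmetric]) auto
    ultimately show "(f i)\<^sup>2 * ennreal (1 / (?d / sqrt (W i))) * ennreal (4 * L / sqrt (W i)) =
        (f i)\<^sup>2 * ennreal (4 * L / ?d)"
      by (simp only: mult.assoc)
  qed
  finally show ?thesis .
qed

end

section \<open>Suprema of averages and the discrete estimate\<close>

lemma SUP_power2_le_ennreal:
  fixes f :: "'a \<Rightarrow> ennreal"
  assumes "\<And>m. m \<in> A \<Longrightarrow> (f m)\<^sup>2 \<le> X"
  shows "(SUP m\<in>A. f m)\<^sup>2 \<le> X"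
proof (cases X)
  case (real x)
  have "f m \<le> ennreal (sqrt x)" if "m \<in> A" for m
  proof (cases "f m")
    case (real y)
    then show ?thesis
      using assms[OF that] \<open>X = ennreal x\<close> \<open>0 \<le> x\<close> by (simp add: ennreal_power real_le_rsqrt)
  next
    case top
    then show ?thesis
      using assms[OF that] \<open>X = ennreal x\<close> by (simp add: top_unique)
  qed
  then have "(SUP m\<in>A. f m)\<^sup>2 \<le> (ennreal (sqrt x))\<^sup>2"
    by (intro power_mono SUP_least) auto
  then show ?thesis using real by (simp add: ennreal_power)
qed auto

text \<open>The averages over larger balls split into the average over the present ball, which is
  handled by Hardy's inequality, and the contribution of the outer annuli, which is an l2 sum.\<close>
lemma sup_of_averages_power2_le:
  fixes f :: "int \<Rightarrow> ennreal" and j :: int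
  defines "F \<equiv> \<lambda>m. (\<integral>\<^sup>+i\<in>{..m}. f i \<partial>count_space UNIV)"
  shows "(SUP m\<in>{j..}. ennreal (2 powr - real_of_int m) * F m)\<^sup>2 \<le>
    2 * (ennreal (2 powr - real_of_int j) * F j)\<^sup>2 +
    4 * (\<integral>\<^sup>+i\<in>{j<..}. (ennreal (2 powr - real_of_int i) * f i)\<^sup>2 \<partial>count_space UNIV)"
    (is "_ \<le> ?R")
proof (rule SUP_power2_le_ennreal)
  fix m assume "m \<in> {j..}"
  then have m: "j \<le> m" by simp
  define e where "e k = 2 powr real_of_int k" for k
  have e_pos: "0 < e k" for k by (simp add: e_def)
  have e_minus: "2 powr - real_of_int k = 1 / e k" for k by (simp add: e_def powr_minus_divide)
  have e_mono: "e i \<le> e k" if "i \<le> k" for i k using that by (simp add: e_def)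
  have e_Suc: "e k = 2 * e (k - 1)" for k by (simp add: e_def powr_diff)
  \<comment> \<open>The outer part of the m-th average is rewritten as a sum of the terms 2^(-i)
    f(i) with weights 2^(i-m). For i \<le> m these weights form a geometric series with sum 2, so
    Cauchy-Schwarz gives a bound independent of m.\<close>
  let ?p = "\<lambda>i. e i / e m * indicator {j<..m} i" and ?g = "\<lambda>i. ennreal (1 / e i) * f i"
  define B where "B = ennreal (1 / e m) * (\<integral>\<^sup>+i\<in>{j<..m}. f i \<partial>count_space UNIV)"
  have "F m = (\<integral>\<^sup>+i. f i * indicator {..j} i + f i * indicator {j<..m} i \<partial>count_space UNIV)"
    unfolding F_def using m by (intro nn_integral_cong) (auto split: split_indicator)
  also have "\<dots> = F j + (\<integral>\<^sup>+i\<in>{j<..m}. f i \<partial>count_space UNIV)"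
    unfolding F_def by (rule nn_integral_add) auto
  finally have "ennreal (1 / e m) * F m = ennreal (1 / e m) * F j + B"
    by (simp add: B_def distrib_left)
  \<comment> \<open>Only the inner part is relaxed from 2^(-m) to 2^(-j). The outer part keeps
    2^(-m), which supplies the decay of the weights.\<close>
  also have "\<dots> \<le> ennreal (1 / e j) * F j + B"
    using e_mono[OF m] e_pos by (intro add_right_mono mult_right_mono ennreal_leI) (auto simp: frac_le)
  finally have "(ennreal (1 / e m) * F m)\<^sup>2 \<le> (ennreal (1 / e j) * F j + B)\<^sup>2"
    by (intro power_mono) auto
  also have "\<dots> \<le> 2 * (ennreal (1 / e j) * F j)\<^sup>2 + 2 * B\<^sup>2"
  proof -
    define a where "a = ennreal (1 / e j) * F j"
    have "2 * a * B = a * B + a * B"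
      by (simp add: mult_2 distrib_right)
    then have "(a + B)\<^sup>2 = a\<^sup>2 + B\<^sup>2 + 2 * a * B"
      by (simp add: power2_eq_square distrib_left distrib_right add_ac mult.commute[of B a])
    also have "\<dots> \<le> a\<^sup>2 + B\<^sup>2 + (a\<^sup>2 + B\<^sup>2)"
      by (intro add_left_mono sum_of_squares_ge_ennreal)
    also have "\<dots> = 2 * a\<^sup>2 + 2 * B\<^sup>2"
      by (simp add: mult_2 add_ac)
    finally show ?thesis by (simp add: a_def)
  qed
  also have "B\<^sup>2 \<le> 2 * (\<integral>\<^sup>+i\<in>{j<..}. (?g i)\<^sup>2 \<partial>count_space UNIV)"
  proof -
    have "B = (\<integral>\<^sup>+i. ennreal (?p i) * ?g i \<partial>count_space UNIV)"
    proof -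
      have "ennreal (e i / e m) * ennreal (1 / e i) = ennreal (1 / e m)" for i
        using e_pos[of i] e_pos[of m] by (simp add: less_imp_le flip: ennreal_mult)
      then have "ennreal (?p i) * ?g i = ennreal (1 / e m) * (f i * indicator {j<..m} i)" for i
        by (auto simp flip: mult.assoc split: split_indicator)
      then show ?thesis by (simp add: B_def nn_integral_cmult)
    qed
    then have "B\<^sup>2 \<le> (\<integral>\<^sup>+i. ennreal (?p i) \<partial>count_space UNIV) *
        (\<integral>\<^sup>+i. ennreal (?p i) * (?g i)\<^sup>2 \<partial>count_space UNIV)"
      using e_pos by (simp only:) (intro weighted_Cauchy_Schwarz_nn_integral, auto simp: less_imp_le)
    also have "\<dots> \<le> 2 * (\<integral>\<^sup>+i\<in>{j<..}. (?g i)\<^sup>2 \<partial>count_space UNIV)"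
    proof (intro mult_mono)
      have "(\<integral>\<^sup>+i. ennreal (?p i) \<partial>count_space UNIV) \<le>
          (\<integral>\<^sup>+i\<in>{..m}. ennreal (e i / e m) \<partial>count_space UNIV)"
        by (intro nn_integral_mono) (auto split: split_indicator)
      also have "\<dots> \<le> ennreal (2 * e m / e m)"
      proof (rule nn_integral_atMost_telescope[where t = "\<lambda>k. 2 * e k / e m"])
        show "e k / e m \<le> 2 * e k / e m - 2 * e (k - 1) / e m" for k
          using e_Suc[of k] by (simp flip: diff_divide_distrib)
      qed (use e_pos in \<open>auto simp: less_imp_le\<close>)
      also have "\<dots> = 2" using e_pos[of m] by simp
      finally show "(\<integral>\<^sup>+i. ennreal (?p i) \<partial>count_space UNIV) \<le> 2" .
      show "(\<integral>\<^sup>+i. ennreal (?p i) * (?g i)\<^sup>2 \<partial>count_space UNIV) \<le>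
          (\<integral>\<^sup>+i\<in>{j<..}. (?g i)\<^sup>2 \<partial>count_space UNIV)"
      proof (intro nn_integral_mono)
        fix i
        \<comment> \<open>In the second Cauchy-Schwarz factor the decay is discarded: every weight
          is at most 1.\<close>
        have "ennreal (?p i) \<le> ennreal (indicator {j<..} i)"
          using e_mono[of i m] e_pos[of m] by (intro ennreal_leI) (auto split: split_indicator)
        then show "ennreal (?p i) * (?g i)\<^sup>2 \<le> (?g i)\<^sup>2 * indicator {j<..} i"
          by (metis ennreal_indicator mult.commute mult_left_mono zero_le)
      qed
    qed auto
    finally show ?thesis .
  qed
  finally show "(ennreal (2 powr - real_of_int m) * F m)\<^sup>2 \<le> ?R"
    by (simp add: e_minus mult.assoc[symmetric] mult_left_mono add_left_mono)
qed

text \<open>Powers of L: one each from Hardy's inequality for W, from the A2 condition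
  and from either Hardy's inequality for \<sigma> or the geometric growth of W.\<close>
lemma discrete_strong_sparse_bound:
  fixes W \<sigma> :: "int \<Rightarrow> real" and f x :: "int \<Rightarrow> ennreal"
  assumes W: "reverse_doubling W L" and \<sigma>: "reverse_doubling \<sigma> L"
    and A2: "\<And>k. W k * \<sigma> k \<le> L * (2 powr real_of_int k)\<^sup>2"
    and f: "\<And>i. (f i)\<^sup>2 \<le> ennreal (\<sigma> i - \<sigma> (i - 1)) * x i"
  defines "b \<equiv> \<lambda>j. SUP m\<in>{j..}. ennreal (2 powr - real_of_int m) *
    (\<integral>\<^sup>+i\<in>{..m}. f i \<partial>count_space UNIV)"
  shows "(\<integral>\<^sup>+k. ennreal (W k - W (k - 1)) * (\<integral>\<^sup>+j\<in>{k..}. b j \<partial>count_space UNIV)\<^sup>2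
    \<partial>count_space UNIV) \<le> ennreal (48 * L ^ 3) * (\<integral>\<^sup>+i. x i \<partial>count_space UNIV)"
proof -
  interpret W: reverse_doubling W L by (fact W)
  interpret \<sigma>: reverse_doubling \<sigma> L by (fact \<sigma>)
  define e where "e k = 2 powr - real_of_int k" for k
  have e_pos: "0 < e k" for k by (simp add: e_def)
  have L: "0 < L" by (fact W.L_pos)
  define F where "F m = (\<integral>\<^sup>+i\<in>{..m}. f i \<partial>count_space UNIV)" for m
  let ?X = "\<integral>\<^sup>+i. x i \<partial>count_space UNIV"
  let ?G = "\<lambda>j. \<integral>\<^sup>+i\<in>{j<..}. (ennreal (e i) * f i)\<^sup>2 \<partial>count_space UNIV"
  \<comment> \<open>This is where W is traded for the reciprocal of its dual; both parts of the
    squared supremum use it.\<close>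
  have A2': "W k * (e k)\<^sup>2 \<le> L / \<sigma> k" for k
    using A2[of k] \<sigma>.pos[of k] by (simp add: e_def powr_minus field_simps)
  have x_le: "(f i)\<^sup>2 * ennreal (1 / (\<sigma> i - \<sigma> (i - 1))) \<le> x i" for i
  proof -
    have "(f i)\<^sup>2 * ennreal (1 / (\<sigma> i - \<sigma> (i - 1))) \<le>
        ennreal (\<sigma> i - \<sigma> (i - 1)) * x i * ennreal (1 / (\<sigma> i - \<sigma> (i - 1)))"
      by (intro mult_right_mono f) auto
    also have "\<dots> = ennreal ((\<sigma> i - \<sigma> (i - 1)) * (1 / (\<sigma> i - \<sigma> (i - 1)))) * x i"
      using \<sigma>.diff_pos[of i] by (subst ennreal_mult) (auto simp: mult_ac)
    also have "\<dots> = x i" using \<sigma>.diff_pos[of i] by simp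
    finally show ?thesis .
  qed
  \<comment> \<open>After the exchange the weight is L / \<open>\<sigma> j\<close>, exactly the
    left-hand weight of the dual Hardy inequality, whose right-hand side is controlled by
    \<open>x_le\<close>.\<close>
  have inner: "(\<integral>\<^sup>+j. ennreal (W j) * (ennreal (e j) * F j)\<^sup>2 \<partial>count_space UNIV) \<le>
      ennreal (4 * L\<^sup>2) * ?X"
  proof -
    have "(\<integral>\<^sup>+j. ennreal (W j) * (ennreal (e j) * F j)\<^sup>2 \<partial>count_space UNIV) \<le>
        (\<integral>\<^sup>+j. ennreal L * (ennreal (1 / \<sigma> j) * (F j)\<^sup>2) \<partial>count_space UNIV)"
    proof (intro nn_integral_mono)
      fix j
      have "ennreal (W j) * (ennreal (e j) * F j)\<^sup>2 = ennreal (W j * (e j)\<^sup>2) * (F j)\<^sup>2"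
        using W.pos[of j] e_pos[of j]
        by (simp add: power_mult_distrib ennreal_power ennreal_mult less_imp_le mult_ac)
      also have "\<dots> \<le> ennreal (L * (1 / \<sigma> j)) * (F j)\<^sup>2"
        using A2'[of j] by (intro mult_right_mono ennreal_leI) auto
      also have "\<dots> = ennreal L * (ennreal (1 / \<sigma> j) * (F j)\<^sup>2)"
        using L \<sigma>.pos[of j] by (subst ennreal_mult) (auto simp: mult.assoc)
      finally show "ennreal (W j) * (ennreal (e j) * F j)\<^sup>2 \<le>
        ennreal L * (ennreal (1 / \<sigma> j) * (F j)\<^sup>2)" .
    qed
    also have "\<dots> = ennreal L * (\<integral>\<^sup>+j. ennreal (1 / \<sigma> j) * (F j)\<^sup>2 \<partial>count_space UNIV)"
      by (simp add: nn_integral_cmult)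
    also have "\<dots> \<le> ennreal L *
        (\<integral>\<^sup>+i. (f i)\<^sup>2 * ennreal (4 * L / (\<sigma> i - \<sigma> (i - 1))) \<partial>count_space UNIV)"
      unfolding F_def by (intro mult_left_mono \<sigma>.Hardy_atMost) auto
    also have "\<dots> \<le> ennreal L * (\<integral>\<^sup>+i. ennreal (4 * L) * x i \<partial>count_space UNIV)"
    proof (intro mult_left_mono nn_integral_mono)
      fix i
      have "(f i)\<^sup>2 * ennreal (4 * L / (\<sigma> i - \<sigma> (i - 1))) =
          ennreal (4 * L) * ((f i)\<^sup>2 * ennreal (1 / (\<sigma> i - \<sigma> (i - 1))))"
      proof -
        have "ennreal (4 * L / (\<sigma> i - \<sigma> (i - 1))) =
            ennreal (4 * L) * ennreal (1 / (\<sigma> i - \<sigma> (i - 1)))"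
          using L \<sigma>.diff_pos[of i] by (subst ennreal_mult[symmetric]) auto
        then show ?thesis by (simp only: mult.left_commute)
      qed
      then show "(f i)\<^sup>2 * ennreal (4 * L / (\<sigma> i - \<sigma> (i - 1))) \<le> ennreal (4 * L) * x i"
        by (simp add: x_le mult_left_mono)
    qed auto
    also have "\<dots> = ennreal (L * (4 * L)) * ?X"
      using L by (subst ennreal_mult) (auto simp: nn_integral_cmult mult.assoc)
    also have "L * (4 * L) = 4 * L\<^sup>2"
      by (simp add: power2_eq_square)
    finally show ?thesis .
  qed
  \<comment> \<open>The order of summation is exchanged so that each f(i) meets the total of
    \<open>W j\<close> over j < i, which is at most \<open>L * W i\<close>; the A2 condition is then
    applied at the scale i itself.\<close>
  have outer: "(\<integral>\<^sup>+j. ennreal (W j) * ?G j \<partial>count_space UNIV) \<le> ennreal (L\<^sup>2) * ?X"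
  proof -
    have "(\<integral>\<^sup>+j. ennreal (W j) * ?G j \<partial>count_space UNIV) =
        (\<integral>\<^sup>+i. (ennreal (e i) * f i)\<^sup>2 *
          (\<integral>\<^sup>+j\<in>{j. i \<in> {j<..}}. ennreal (W j) \<partial>count_space UNIV) \<partial>count_space UNIV)"
      by (rule nn_integral_count_space_swap)
    also have "\<dots> \<le> (\<integral>\<^sup>+i. ennreal (L\<^sup>2) * x i \<partial>count_space UNIV)"
    proof (intro nn_integral_mono)
      fix i
      have "(\<integral>\<^sup>+j\<in>{j. i \<in> {j<..}}. ennreal (W j) \<partial>count_space UNIV) \<le>
          (\<integral>\<^sup>+j\<in>{..i}. ennreal (W j) \<partial>count_space UNIV)"
        by (intro nn_integral_mono) (auto split: split_indicator)
      also have "\<dots> \<le> ennreal (L * W i)" by (rule W.sum_atMost_le)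
      finally have "(ennreal (e i) * f i)\<^sup>2 *
          (\<integral>\<^sup>+j\<in>{j. i \<in> {j<..}}. ennreal (W j) \<partial>count_space UNIV) \<le>
          (ennreal (e i) * f i)\<^sup>2 * ennreal (L * W i)"
        by (intro mult_left_mono) auto
      also have "\<dots> = (f i)\<^sup>2 * ennreal (L * (W i * (e i)\<^sup>2))"
        using L W.pos[of i] e_pos[of i]
        by (simp add: power_mult_distrib ennreal_power ennreal_mult less_imp_le mult_ac)
      also have "\<dots> \<le> (f i)\<^sup>2 * ennreal (L\<^sup>2 * (1 / (\<sigma> i - \<sigma> (i - 1))))"
      proof (intro mult_left_mono ennreal_leI)
        have "L * (W i * (e i)\<^sup>2) \<le> L * (L / \<sigma> i)"
          using L A2'[of i] by (intro mult_left_mono) auto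
        \<comment> \<open>A ball has at least the mass of its outer annulus.\<close>
        also have "\<dots> \<le> L * (L / (\<sigma> i - \<sigma> (i - 1)))"
          using L \<sigma>.pos[of "i - 1"] \<sigma>.diff_pos[of i] \<sigma>.pos[of i]
          by (intro mult_left_mono divide_left_mono) auto
        finally show "L * (W i * (e i)\<^sup>2) \<le> L\<^sup>2 * (1 / (\<sigma> i - \<sigma> (i - 1)))"
          by (simp add: power2_eq_square)
      qed auto
      also have "\<dots> = ennreal (L\<^sup>2) * ((f i)\<^sup>2 * ennreal (1 / (\<sigma> i - \<sigma> (i - 1))))"
        using \<sigma>.diff_pos[of i] by (subst ennreal_mult) (auto simp: mult.left_commute)
      also have "\<dots> \<le> ennreal (L\<^sup>2) * x i"
        by (intro mult_left_mono x_le) auto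
      finally show "(ennreal (e i) * f i)\<^sup>2 *
          (\<integral>\<^sup>+j\<in>{j. i \<in> {j<..}}. ennreal (W j) \<partial>count_space UNIV) \<le> ennreal (L\<^sup>2) * x i" .
    qed
    also have "\<dots> = ennreal (L\<^sup>2) * ?X" by (simp add: nn_integral_cmult)
    finally show ?thesis .
  qed
  have "(\<integral>\<^sup>+k. ennreal (W k - W (k - 1)) * (\<integral>\<^sup>+j\<in>{k..}. b j \<partial>count_space UNIV)\<^sup>2
      \<partial>count_space UNIV) \<le> (\<integral>\<^sup>+j. (b j)\<^sup>2 * ennreal (4 * L * W j) \<partial>count_space UNIV)"
    by (rule W.Hardy_atLeast)
  also have "\<dots> \<le> (\<integral>\<^sup>+j. ennreal (4 * L) * (2 * (ennreal (W j) * (ennreal (e j) * F j)\<^sup>2) +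
      4 * (ennreal (W j) * ?G j)) \<partial>count_space UNIV)"
  proof (intro nn_integral_mono)
    fix j
    have "(b j)\<^sup>2 * ennreal (4 * L * W j) \<le>
        (2 * (ennreal (e j) * F j)\<^sup>2 + 4 * ?G j) * ennreal (4 * L * W j)"
      unfolding b_def F_def e_def by (intro mult_right_mono sup_of_averages_power2_le) auto
    also have "\<dots> = (2 * (ennreal (e j) * F j)\<^sup>2 + 4 * ?G j) * (ennreal (4 * L) * ennreal (W j))"
      using L W.pos[of j] by (subst ennreal_mult[symmetric]) auto
    also have "(2 * y + 4 * z) * (l * v) = l * (2 * (v * y) + 4 * (v * z))" for y z l v :: ennreal
      by (simp add: distrib_left distrib_right mult_ac)
    finally show "(b j)\<^sup>2 * ennreal (4 * L * W j) \<le>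
        ennreal (4 * L) * (2 * (ennreal (W j) * (ennreal (e j) * F j)\<^sup>2) + 4 * (ennreal (W j) * ?G j))" .
  qed
  also have "\<dots> = ennreal (4 * L) *
      (2 * (\<integral>\<^sup>+j. ennreal (W j) * (ennreal (e j) * F j)\<^sup>2 \<partial>count_space UNIV) +
       4 * (\<integral>\<^sup>+j. ennreal (W j) * ?G j \<partial>count_space UNIV))"
    by (simp add: nn_integral_cmult nn_integral_add)
  also have "\<dots> \<le> ennreal (4 * L) * (2 * (ennreal (4 * L\<^sup>2) * ?X) + 4 * (ennreal (L\<^sup>2) * ?X))"
    by (intro mult_left_mono add_mono inner outer) auto
  \<comment> \<open>The constant is 12 = 2 * 4 + 4 * 1 from the inner and outer parts; the factor 4
    L of Hardy's inequality makes it 48 L^3.\<close>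
  also have "\<dots> = ennreal (4 * L) * (ennreal (12 * L\<^sup>2) * ?X)"
  proof -
    define Y where "Y = ennreal (L\<^sup>2) * ?X"
    have "2 * (ennreal (4 * L\<^sup>2) * ?X) + 4 * Y = 8 * Y + 4 * Y"
      by (simp add: Y_def ennreal_mult mult.assoc)
    also have "\<dots> = 12 * Y" by (simp flip: distrib_right)
    also have "\<dots> = ennreal (12 * L\<^sup>2) * ?X"
      by (simp add: Y_def ennreal_mult mult.assoc)
    finally show ?thesis by (simp only: Y_def)
  qed
  also have "\<dots> = ennreal (48 * L ^ 3) * ?X"
    using L by (simp add: power2_eq_square power3_eq_cube flip: mult.assoc ennreal_mult)
  finally show ?thesis .
qed

section \<open>Intervals and dyadic annuli\<close>

text \<open>Endpoints may or may not belong to A, so A is only enclosed between an open and a closed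
  interval; these have equal length, which fixes the measure.\<close>

lemma intervals_shape:
  assumes "A \<in> intervals"
  obtains a b where "a < b" "{a<..<b} \<subseteq> A" "A \<subseteq> {a..b}" "measure lebesgue A = b - a"
proof -
  have A: "is_interval A" "bounded A" "measure lebesgue A > 0"
    using assms by (auto simp: intervals_def)
  have ne: "A \<noteq> {}" using A(3) by auto
  have bdd: "bdd_below A" "bdd_above A"
    using A(2) by (auto simp: bounded_imp_bdd_below bounded_imp_bdd_above)
  define a b where "a = Inf A" and "b = Sup A"
  have sub: "A \<subseteq> {a..b}"
    using bdd by (auto simp: a_def b_def intro: cInf_lower cSup_upper)
  have sup: "{a<..<b} \<subseteq> A"
  proof
    fix x assume x: "x \<in> {a<..<b}"
    obtain u where "u \<in> A" "u < x"
      using x ne bdd by (auto simp: a_def cInf_less_iff)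
    moreover obtain v where "v \<in> A" "x < v"
      using x ne bdd by (auto simp: b_def less_cSup_iff)
    ultimately show "x \<in> A"
      using A(1) by (meson is_interval_1 less_imp_le)
  qed
  have "a \<le> b" using sub ne by fastforce
  have meas: "A \<in> lmeasurable"
    using A by (auto intro: measurable_convex is_interval_convex)
  have "measure lebesgue A \<le> measure lebesgue {a..b}"
    using sub meas by (intro measure_mono_fmeasurable) auto
  moreover have "measure lebesgue {a<..<b} \<le> measure lebesgue A"
    using sup meas by (intro measure_mono_fmeasurable) auto
  ultimately have "measure lebesgue A = b - a"
    using \<open>a \<le> b\<close> by simp
  then show ?thesis using that A(3) sub sup by auto
qed

lemma intervals_lmeasurable: "A \<in> intervals \<Longrightarrow> A \<in> lmeasurable"
  unfolding intervals_def by (auto intro: measurable_convex is_interval_convex)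

lemma Icc_in_intervals: "a < b \<Longrightarrow> {a..b} \<in> intervals"
  by (auto simp: intervals_def is_interval_1)

text \<open>The radius is the full length of A because c can be anywhere in the closure, including
  an endpoint.\<close>

lemma interval_subset_centered:
  assumes "A \<in> intervals" "c \<in> closure A"
  shows "A \<subseteq> {c - measure lebesgue A..c + measure lebesgue A}"
proof -
  obtain a b where ab: "a < b" "A \<subseteq> {a..b}" "measure lebesgue A = b - a"
    using intervals_shape[OF assms(1)] by metis
  have "closure A \<subseteq> {a..b}"
    by (rule closure_minimal) (use ab in auto)
  then have "a \<le> c" "c \<le> b" using assms(2) by auto
  then show ?thesis using ab by auto
qed

text \<open>Nested nonempty compact sets meet. Closures are essential: the intervals (0, 1/n) form a
  chain with empty intersection.\<close>

lemma chain_of_intervals_center: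
  assumes "\<S> \<subseteq> intervals" and "\<forall>A\<in>\<S>. \<forall>B\<in>\<S>. A \<subseteq> B \<or> B \<subseteq> A"
  obtains c where "\<And>A. A \<in> \<S> \<Longrightarrow> c \<in> closure A"
proof -
  have "\<Inter> (closure ` \<S>) \<noteq> {}"
  proof (rule compact_chain)
    show "compact S" if "S \<in> closure ` \<S>" for S
      using that assms(1) by (auto simp: intervals_def)
    have "closure A \<noteq> {}" if "A \<in> \<S>" for A
      using assms(1) that by (auto simp: intervals_def)
    then show "{} \<notin> closure ` \<S>" by (metis (no_types, lifting) imageE)
    show "S \<subseteq> T \<or> T \<subseteq> S" if "S \<in> closure ` \<S> \<and> T \<in> closure ` \<S>" for S T
      using that assms(2) by (metis (no_types, lifting) closure_mono imageE)
  qed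
  then show ?thesis using that by blast
qed

definition cent_ball :: "real \<Rightarrow> int \<Rightarrow> real set" where
  "cent_ball c k = {c - 2 powr real_of_int k..c + 2 powr real_of_int k}"

definition annulus :: "real \<Rightarrow> int \<Rightarrow> real set" where
  "annulus c k = cent_ball c k - cent_ball c (k - 1)"

lemma cent_ball_iff: "x \<in> cent_ball c k \<longleftrightarrow> \<bar>x - c\<bar> \<le> 2 powr real_of_int k"
  by (auto simp: cent_ball_def)

lemma cent_ball_mono: "j \<le> k \<Longrightarrow> cent_ball c j \<subseteq> cent_ball c k"
  unfolding cent_ball_iff subset_iff
  by (meson of_int_le_iff one_le_numeral order_trans powr_mono)

lemma cent_ball_in_intervals: "cent_ball c k \<in> intervals"
  by (auto simp: cent_ball_def intro: Icc_in_intervals)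

lemma cent_ball_measurable [measurable]: "cent_ball c k \<in> sets lebesgue"
  by (simp add: cent_ball_def)

lemma annulus_measurable [measurable]: "annulus c k \<in> sets lebesgue"
  by (simp add: annulus_def)

text \<open>The ceiling of the logarithm determines the annulus, so the annuli partition the line
  without c.\<close>

lemma annulus_iff:
  assumes "x \<noteq> c"
  shows "x \<in> annulus c k \<longleftrightarrow> k = \<lceil>log 2 \<bar>x - c\<bar>\<rceil>"
proof -
  have pos: "0 < \<bar>x - c\<bar>" using assms by simp
  have "x \<in> annulus c k \<longleftrightarrow> 2 powr (real_of_int k - 1) < \<bar>x - c\<bar> \<and> \<bar>x - c\<bar> \<le> 2 powr real_of_int k"
    by (auto simp: annulus_def cent_ball_iff)
  also have "\<dots> \<longleftrightarrow> real_of_int k - 1 < log 2 \<bar>x - c\<bar> \<and> log 2 \<bar>x - c\<bar> \<le> real_of_int k"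
    using pos by (simp add: less_log_iff log_le_iff)
  also have "\<dots> \<longleftrightarrow> \<lceil>log 2 \<bar>x - c\<bar>\<rceil> = k" by (simp add: ceiling_eq_iff)
  finally show ?thesis by auto
qed

lemma AE_lebesgue_neq: "AE x in lebesgue. x \<noteq> (c::real)"
  by (rule AE_I[of _ _ "{c}"]) auto

lemma sum_annuli_indicator:
  fixes g :: ennreal
  assumes "x \<noteq> c"
  shows "(\<integral>\<^sup>+i\<in>J. g * indicator (annulus c i) x \<partial>count_space UNIV) =
    g * indicator J \<lceil>log 2 \<bar>x - c\<bar>\<rceil>"
proof -
  let ?k = "\<lceil>log 2 \<bar>x - c\<bar>\<rceil>"
  define h where "h i = g * indicator (annulus c i) x * indicator J i" for i
  have "(\<integral>\<^sup>+i. h i \<partial>count_space UNIV) = (\<Sum>i\<in>{?k}. h i)"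
    by (rule nn_integral_count_space') (auto simp: h_def annulus_iff[OF assms])
  also have "\<dots> = h ?k" by simp
  finally show ?thesis by (simp add: h_def annulus_iff[OF assms])
qed

lemma nn_integral_annuli_swap:
  fixes h :: "int \<Rightarrow> real \<Rightarrow> ennreal"
  assumes [measurable]: "\<And>i. h i \<in> borel_measurable lebesgue"
  shows "(\<integral>\<^sup>+x. (\<integral>\<^sup>+i\<in>J. h i x * indicator (annulus c i) x \<partial>count_space UNIV) \<partial>lebesgue) =
    (\<integral>\<^sup>+i\<in>J. (\<integral>\<^sup>+x\<in>annulus c i. h i x \<partial>lebesgue) \<partial>count_space UNIV)"
  by (subst nn_integral_count_space_nn_integral) (auto simp: nn_integral_multc)

lemma nn_integral_cent_ball:
  assumes [measurable]: "g \<in> borel_measurable lebesgue"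
  shows "(\<integral>\<^sup>+x\<in>cent_ball c m. g x \<partial>lebesgue) =
    (\<integral>\<^sup>+i\<in>{..m}. (\<integral>\<^sup>+x\<in>annulus c i. g x \<partial>lebesgue) \<partial>count_space UNIV)"
proof -
  have "(\<integral>\<^sup>+x\<in>cent_ball c m. g x \<partial>lebesgue) =
    (\<integral>\<^sup>+x. (\<integral>\<^sup>+i\<in>{..m}. g x * indicator (annulus c i) x \<partial>count_space UNIV) \<partial>lebesgue)"
  \<comment> \<open>The centre lies in every ball but in no annulus, so the integrands are compared
    off the null set {c}.\<close>
  proof (rule nn_integral_cong_AE, rule eventually_mono[OF AE_lebesgue_neq[of c]])
    fix x assume "x \<noteq> c"
    then have "x \<in> cent_ball c m \<longleftrightarrow> \<lceil>log 2 \<bar>x - c\<bar>\<rceil> \<le> m"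
      by (simp add: cent_ball_iff ceiling_le_iff log_le_iff)
    then show "g x * indicator (cent_ball c m) x =
        (\<integral>\<^sup>+i\<in>{..m}. g x * indicator (annulus c i) x \<partial>count_space UNIV)"
      by (simp only: sum_annuli_indicator[OF \<open>x \<noteq> c\<close>]) (simp add: indicator_def)
  qed
  also have "\<dots> = (\<integral>\<^sup>+i\<in>{..m}. (\<integral>\<^sup>+x\<in>annulus c i. g x \<partial>lebesgue) \<partial>count_space UNIV)"
    by (rule nn_integral_annuli_swap) auto
  finally show ?thesis .
qed

lemma nn_integral_annuli:
  assumes [measurable]: "g \<in> borel_measurable lebesgue"
  shows "(\<integral>\<^sup>+i. (\<integral>\<^sup>+x\<in>annulus c i. g x \<partial>lebesgue) \<partial>count_space UNIV) = (\<integral>\<^sup>+x. g x \<partial>lebesgue)"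
proof -
  have "(\<integral>\<^sup>+x. g x \<partial>lebesgue) =
    (\<integral>\<^sup>+x. (\<integral>\<^sup>+i\<in>UNIV. g x * indicator (annulus c i) x \<partial>count_space UNIV) \<partial>lebesgue)"
  proof (rule nn_integral_cong_AE, rule eventually_mono[OF AE_lebesgue_neq[of c]])
    fix x assume "x \<noteq> c"
    show "g x = (\<integral>\<^sup>+i\<in>UNIV. g x * indicator (annulus c i) x \<partial>count_space UNIV)"
      by (simp only: sum_annuli_indicator[OF \<open>x \<noteq> c\<close>]) simp
  qed
  also have "\<dots> = (\<integral>\<^sup>+i\<in>UNIV. (\<integral>\<^sup>+x\<in>annulus c i. g x \<partial>lebesgue) \<partial>count_space UNIV)"
    by (rule nn_integral_annuli_swap) auto
  finally show ?thesis by simp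
qed

text \<open>The function h is arbitrary and only its majorant, constant multiples of w on annuli, is
  decomposed. Measurability of \<open>strong_sparse\<close> thus never becomes an issue, nor does
  its value at c, where all members of the chain may overlap.\<close>

lemma nn_integral_le_annuli:
  fixes K :: "int \<Rightarrow> ennreal"
  assumes [measurable]: "w \<in> borel_measurable lebesgue"
    and le: "\<And>x k. x \<in> annulus c k \<Longrightarrow> h x \<le> K k * w x"
  shows "(\<integral>\<^sup>+x. h x \<partial>lebesgue) \<le>
    (\<integral>\<^sup>+k. K k * (\<integral>\<^sup>+x\<in>annulus c k. w x \<partial>lebesgue) \<partial>count_space UNIV)"
proof -
  have "(\<integral>\<^sup>+x. h x \<partial>lebesgue) \<le>
    (\<integral>\<^sup>+x. (\<integral>\<^sup>+k\<in>UNIV. K k * w x * indicator (annulus c k) x \<partial>count_space UNIV) \<partial>lebesgue)"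
  proof (rule nn_integral_mono_AE, rule eventually_mono[OF AE_lebesgue_neq[of c]])
    fix x assume "x \<noteq> c"
    let ?k = "\<lceil>log 2 \<bar>x - c\<bar>\<rceil>"
    have k: "x \<in> annulus c ?k" using \<open>x \<noteq> c\<close> by (simp add: annulus_iff)
    have "h x \<le> K ?k * w x * indicator (annulus c ?k) x * indicator UNIV ?k"
      using le[OF k] k by simp
    also have "\<dots> \<le> (\<integral>\<^sup>+k\<in>UNIV. K k * w x * indicator (annulus c k) x \<partial>count_space UNIV)"
      by (rule nn_integral_ge_point) simp
    finally show "h x \<le> (\<integral>\<^sup>+k\<in>UNIV. K k * w x * indicator (annulus c k) x \<partial>count_space UNIV)" .
  qed
  also have "\<dots> = (\<integral>\<^sup>+k\<in>UNIV. (\<integral>\<^sup>+x\<in>annulus c k. K k * w x \<partial>lebesgue) \<partial>count_space UNIV)"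
    by (rule nn_integral_annuli_swap) auto
  also have "\<dots> = (\<integral>\<^sup>+k. K k * (\<integral>\<^sup>+x\<in>annulus c k. w x \<partial>lebesgue) \<partial>count_space UNIV)"
    by (simp add: nn_integral_cmult mult.assoc)
  finally show ?thesis .
qed

section \<open>Dyadic scales and sparse counting\<close>

text \<open>Rounding the length up makes the ball of radius 2^k about any point of the closure
  contain A, while 2^k stays within a factor 2 of the length.\<close>

definition dyadic_scale :: "real set \<Rightarrow> int" where
  "dyadic_scale A = \<lfloor>log 2 (measure lebesgue A)\<rfloor> + 1"

lemma dyadic_scale_bounds:
  assumes "A \<in> intervals"
  shows "measure lebesgue A \<le> 2 powr real_of_int (dyadic_scale A)"
    and "2 powr real_of_int (dyadic_scale A) \<le> 2 * measure lebesgue A"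
proof -
  have pos: "0 < measure lebesgue A" using assms by (simp add: intervals_def)
  have "log 2 (measure lebesgue A) \<le> real_of_int (dyadic_scale A)"
    unfolding dyadic_scale_def by linarith
  then show "measure lebesgue A \<le> 2 powr real_of_int (dyadic_scale A)"
    using pos by (simp add: log_le_iff)
  have "real_of_int (dyadic_scale A) - 1 \<le> log 2 (measure lebesgue A)"
    unfolding dyadic_scale_def by linarith
  then have "2 powr (real_of_int (dyadic_scale A) - 1) \<le> measure lebesgue A"
    using pos by (simp add: le_log_iff)
  then show "2 powr real_of_int (dyadic_scale A) \<le> 2 * measure lebesgue A"
    by (simp add: powr_diff)
qed

lemma dyadic_scale_mono:
  assumes "A \<in> intervals" "B \<in> intervals" "A \<subseteq> B"
  shows "dyadic_scale A \<le> dyadic_scale B"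
proof -
  have "0 < measure lebesgue A" using assms by (simp add: intervals_def)
  moreover have "measure lebesgue A \<le> measure lebesgue B"
    using assms by (intro measure_mono_fmeasurable) (auto intro: intervals_lmeasurable fmeasurableD)
  ultimately show ?thesis by (simp add: dyadic_scale_def floor_mono)
qed

lemma interval_subset_cent_ball:
  assumes "A \<in> intervals" "c \<in> closure A"
  shows "A \<subseteq> cent_ball c (dyadic_scale A)"
  using interval_subset_centered[OF assms] dyadic_scale_bounds(1)[OF assms(1)]
  by (fastforce simp: cent_ball_def)

text \<open>Every competitor I containing A also has c in its closure, hence lies in the ball of its
  own scale m, which is at least that of A. The factor 2 is the rounding error in 1/|I| \<le> 2 *
  2^(-m).\<close>

lemma M_avg_le:
  assumes A: "A \<in> intervals" "c \<in> closure A" and [measurable]: "f \<in> borel_measurable lebesgue"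
  shows "M_avg A f \<le> 2 * (SUP m\<in>{dyadic_scale A..}. ennreal (2 powr - real_of_int m) *
    (\<integral>\<^sup>+i\<in>{..m}. (\<integral>\<^sup>+x\<in>annulus c i. ennreal \<bar>f x\<bar> \<partial>lebesgue) \<partial>count_space UNIV))"
  unfolding M_avg_def
proof (rule SUP_least)
  fix I assume "I \<in> {I \<in> intervals. A \<subseteq> I}"
  then have I: "I \<in> intervals" "A \<subseteq> I" by auto
  then have c: "c \<in> closure I" using A(2) closure_mono by blast
  let ?m = "dyadic_scale I"
  let ?G = "\<lambda>m. ennreal (2 powr - real_of_int m) *
    (\<integral>\<^sup>+i\<in>{..m}. (\<integral>\<^sup>+x\<in>annulus c i. ennreal \<bar>f x\<bar> \<partial>lebesgue) \<partial>count_space UNIV)"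
  have pos: "0 < measure lebesgue I" using I by (simp add: intervals_def)
  have "inverse (measure lebesgue I) \<le> 2 * 2 powr - real_of_int ?m"
    using dyadic_scale_bounds(2)[OF I(1)] pos by (simp add: powr_minus field_simps)
  then have "ennreal (inverse (measure lebesgue I)) \<le> ennreal (2 * 2 powr - real_of_int ?m)"
    by (rule ennreal_leI)
  then have "inverse (emeasure lebesgue I) \<le> 2 * ennreal (2 powr - real_of_int ?m)"
    using intervals_lmeasurable[OF I(1)] pos
    by (simp add: emeasure_eq_measure2 inverse_ennreal ennreal_mult')
  moreover have "(\<integral>\<^sup>+x\<in>I. ennreal \<bar>f x\<bar> \<partial>lebesgue) \<le> (\<integral>\<^sup>+x\<in>cent_ball c ?m. ennreal \<bar>f x\<bar> \<partial>lebesgue)"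
    using interval_subset_cent_ball[OF I(1) c]
    by (intro nn_integral_mono) (auto split: split_indicator)
  ultimately have "avg f I \<le> (\<integral>\<^sup>+x\<in>cent_ball c ?m. ennreal \<bar>f x\<bar> \<partial>lebesgue) *
      (2 * ennreal (2 powr - real_of_int ?m))"
    unfolding avg_def divide_ennreal_def by (intro mult_mono) auto
  also have "\<dots> = 2 * ?G ?m"
    by (subst nn_integral_cent_ball) (auto simp: mult_ac)
  also have "\<dots> \<le> 2 * (SUP m\<in>{dyadic_scale A..}. ?G m)"
    using dyadic_scale_mono[OF A(1) I] by (intro mult_left_mono SUP_upper) auto
  finally show "avg f I \<le> 2 * (SUP m\<in>{dyadic_scale A..}. ?G m)" .
qed

text \<open>A packing argument: the disjoint sets \<open>E A\<close> have measure at least \<gamma>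
  2^k / 2 each, and all lie in one ball of length 2 * 2^k.\<close>

lemma sparse_card_le:
  assumes "0 < \<gamma>" "sparse_family \<gamma> \<S>" and c: "\<And>A. A \<in> \<S> \<Longrightarrow> c \<in> closure A"
    and G: "finite G" "G \<subseteq> \<S>" "\<And>A. A \<in> G \<Longrightarrow> dyadic_scale A = k"
  shows "real (card G) \<le> 4 / \<gamma>"
proof -
  obtain E where \<S>: "\<S> \<subseteq> intervals" and dis: "disjoint_family_on E \<S>"
    and E: "\<And>A. A \<in> \<S> \<Longrightarrow> E A \<in> sets lebesgue \<and> E A \<subseteq> A \<and>
      measure lebesgue (E A) \<ge> \<gamma> * measure lebesgue A"
    using assms(2) unfolding sparse_family_def by metis
  let ?e = "2 powr real_of_int k"
  have GE: "E A \<in> lmeasurable" if "A \<in> G" for A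
    using that G E \<S> by (meson fmeasurableI2 intervals_lmeasurable subsetD)
  have "real (card G) * (\<gamma> * (?e / 2)) = (\<Sum>A\<in>G. \<gamma> * (?e / 2))" by simp
  also have "\<dots> \<le> (\<Sum>A\<in>G. measure lebesgue (E A))"
  proof (rule sum_mono)
    fix A assume A: "A \<in> G"
    then have "?e / 2 \<le> measure lebesgue A"
      using dyadic_scale_bounds(2)[of A] G \<S> by auto
    then have "\<gamma> * (?e / 2) \<le> \<gamma> * measure lebesgue A" using assms(1) by simp
    also have "\<dots> \<le> measure lebesgue (E A)" using E A G by blast
    finally show "\<gamma> * (?e / 2) \<le> measure lebesgue (E A)" .
  qed
  also have "\<dots> = measure lebesgue (\<Union>A\<in>G. E A)"
  proof (rule measure_finite_Union[symmetric])
    show "disjoint_family_on E G" using dis G by (auto simp: disjoint_family_on_def)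
    show "emeasure lebesgue (E A) \<noteq> \<infinity>" if "A \<in> G" for A
      using fmeasurableD2[OF GE[OF that]] by simp
  qed (use G GE in auto)
  also have "\<dots> \<le> measure lebesgue (cent_ball c k)"
  proof (rule measure_mono_fmeasurable)
    show "(\<Union>A\<in>G. E A) \<subseteq> cent_ball c k"
      using G E \<S> c interval_subset_cent_ball by (smt (verit, best) UN_least subset_iff)
    show "(\<Union>A\<in>G. E A) \<in> sets lebesgue" using G GE by (auto intro: fmeasurableD)
  qed (auto simp: cent_ball_def)
  also have "\<dots> = 2 * ?e" by (simp add: cent_ball_def)
  finally have "real (card G) * \<gamma> * ?e \<le> 4 * ?e" by simp
  then show ?thesis using assms(1) by (simp add: field_simps)
qed

text \<open>Grouping the members by scale replaces the sum over the chain by a sum over integers.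
  The constant is 8 / \<gamma> = 2 * (4 / \<gamma>), from the averages and from the count per
  scale.\<close>

lemma strong_sparse_le:
  assumes "0 < \<gamma>" "sparse_family \<gamma> \<S>" and c: "\<And>A. A \<in> \<S> \<Longrightarrow> c \<in> closure A"
    and f: "f \<in> borel_measurable lebesgue" and x: "x \<in> annulus c k"
  defines "b \<equiv> \<lambda>j. SUP m\<in>{j..}. ennreal (2 powr - real_of_int m) *
    (\<integral>\<^sup>+i\<in>{..m}. (\<integral>\<^sup>+x\<in>annulus c i. ennreal \<bar>f x\<bar> \<partial>lebesgue) \<partial>count_space UNIV)"
  shows "strong_sparse \<S> f x \<le> ennreal (8 / \<gamma>) * (\<integral>\<^sup>+j\<in>{k..}. b j \<partial>count_space UNIV)"
  unfolding strong_sparse_def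
proof (rule infsum_le_finite_sums)
  fix G assume G: "finite G" "G \<subseteq> \<S>"
  have \<S>: "\<S> \<subseteq> intervals" using assms(2) by (simp add: sparse_family_def)
  have "(\<Sum>A\<in>G. M_avg A f * indicator A x) \<le> (\<Sum>A\<in>G. 2 * (b (dyadic_scale A) * indicator {k..} (dyadic_scale A)))"
  proof (rule sum_mono)
    fix A assume "A \<in> G"
    then have A: "A \<in> intervals" "c \<in> closure A" using G \<S> c by auto
    \<comment> \<open>A member of smaller scale is contained in the ball of index k - 1, which the
      k-th annulus avoids.\<close>
    have "k \<le> dyadic_scale A" if "x \<in> A"
    proof (rule ccontr)
      assume "\<not> k \<le> dyadic_scale A"
      then have "cent_ball c (dyadic_scale A) \<subseteq> cent_ball c (k - 1)" by (intro cent_ball_mono) simp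
      then show False
        using interval_subset_cent_ball[OF A] that x by (auto simp: annulus_def)
    qed
    then show "M_avg A f * indicator A x \<le> 2 * (b (dyadic_scale A) * indicator {k..} (dyadic_scale A))"
      using M_avg_le[OF A f] by (auto simp: b_def split: split_indicator)
  qed
  also have "\<dots> = (\<Sum>j\<in>dyadic_scale ` G. \<Sum>A\<in>{A \<in> G. dyadic_scale A = j}. 2 * (b (dyadic_scale A) * indicator {k..} (dyadic_scale A)))"
    by (rule sum.image_gen[OF G(1)])
  also have "\<dots> \<le> (\<Sum>j\<in>dyadic_scale ` G. ennreal (8 / \<gamma>) * (b j * indicator {k..} j))"
  proof (rule sum_mono)
    fix j
    let ?n = "card {A \<in> G. dyadic_scale A = j}"
    have "real ?n \<le> 4 / \<gamma>"
      using G by (intro sparse_card_le[OF assms(1,2) c]) auto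
    then have "real ?n * 2 \<le> 8 / \<gamma>" by simp
    then have "ennreal (real ?n * 2) \<le> ennreal (8 / \<gamma>)" by (rule ennreal_leI)
    then have n: "of_nat ?n * 2 \<le> ennreal (8 / \<gamma>)"
      by (simp add: ennreal_mult ennreal_of_nat_eq_real_of_nat)
    have "(\<Sum>A\<in>{A \<in> G. dyadic_scale A = j}. 2 * (b (dyadic_scale A) * indicator {k..} (dyadic_scale A))) =
        of_nat ?n * 2 * (b j * indicator {k..} j)"
      by (simp add: mult.assoc)
    also have "\<dots> \<le> ennreal (8 / \<gamma>) * (b j * indicator {k..} j)"
      by (intro mult_right_mono n) auto
    finally show "(\<Sum>A\<in>{A \<in> G. dyadic_scale A = j}. 2 * (b (dyadic_scale A) * indicator {k..} (dyadic_scale A))) \<le>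
        ennreal (8 / \<gamma>) * (b j * indicator {k..} j)" .
  qed
  also have "\<dots> = ennreal (8 / \<gamma>) * (\<integral>\<^sup>+j. b j * indicator {k..} j \<partial>count_space (dyadic_scale ` G))"
    using G(1) by (simp only: nn_integral_count_space_finite finite_imageI sum_distrib_left)
  also have "\<dots> \<le> ennreal (8 / \<gamma>) * (\<integral>\<^sup>+j\<in>{k..}. b j \<partial>count_space UNIV)"
    by (intro mult_left_mono, subst nn_integral_count_space_indicator)
      (auto intro!: nn_integral_mono split: split_indicator)
  finally show "(\<Sum>A\<in>G. M_avg A f * indicator A x) \<le>
    ennreal (8 / \<gamma>) * (\<integral>\<^sup>+j\<in>{k..}. b j \<partial>count_space UNIV)" .
qed (rule nonneg_summable_on_complete, simp)

section \<open>A2 weights\<close>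

lemma A2_const_inverse: "A2_const (\<lambda>x. inverse (w x)) = A2_const w"
  by (simp add: A2_const_def mult.commute)

lemma A2_weight_inverse: "A2_weight w \<Longrightarrow> A2_weight (\<lambda>x. inverse (w x))"
  by (auto simp: A2_weight_def weight_def A2_const_inverse)

lemma weight_set_integral_pos:
  assumes "weight w" "I \<in> intervals"
  shows "0 < (\<integral>\<^sup>+x\<in>I. ennreal (w x) \<partial>lebesgue)"
proof (rule ccontr)
  have [measurable]: "w \<in> borel_measurable lebesgue" "I \<in> sets lebesgue"
    using assms intervals_lmeasurable by (auto simp: weight_def)
  assume "\<not> ?thesis"
  then have "(\<integral>\<^sup>+x. ennreal (w x) * indicator I x \<partial>lebesgue) = 0" by simp
  then have "AE x in lebesgue. ennreal (w x) * indicator I x = 0"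
    by (subst (asm) nn_integral_0_iff_AE) auto
  then have "AE x in lebesgue. x \<notin> I"
    using assms(1) by (auto simp: weight_def ennreal_eq_0_iff not_le[symmetric] split: split_indicator_asm elim!: eventually_mono)
  then have "I \<in> null_sets lebesgue"
    using AE_iff_null_sets \<open>I \<in> sets lebesgue\<close> by blast
  then show False using assms(2) by (auto simp: intervals_def measure_eq_0_null_sets)
qed

text \<open>The second part follows from the first: the product is finite and the dual factor is
  nonzero, so the factor of w cannot be infinite.\<close>

lemma A2_interval:
  assumes "A2_weight w" "I \<in> intervals"
  shows "(\<integral>\<^sup>+x\<in>I. ennreal (w x) \<partial>lebesgue) * (\<integral>\<^sup>+x\<in>I. ennreal (inverse (w x)) \<partial>lebesgue)
      \<le> A2_const w * ennreal ((measure lebesgue I)\<^sup>2)" (is "?a * ?s \<le> _")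
    and "(\<integral>\<^sup>+x\<in>I. ennreal (w x) \<partial>lebesgue) < \<infinity>"
proof -
  have w: "weight w" "weight (\<lambda>x. inverse (w x))" "A2_const w < \<infinity>"
    using assms(1) A2_weight_inverse[OF assms(1)] by (auto simp: A2_weight_def)
  have w_pos: "0 < w x" for x using w(1) by (simp add: weight_def)
  define v where "v = measure lebesgue I"
  have v: "0 < v" "emeasure lebesgue I = ennreal v"
    using assms(2) intervals_lmeasurable[OF assms(2)]
    by (auto simp: v_def intervals_def emeasure_eq_measure2)
  have abs_w: "ennreal \<bar>w x\<bar> = ennreal (w x)" "ennreal \<bar>inverse (w x)\<bar> = ennreal (inverse (w x))" for x
    using w_pos[of x] by auto
  have "avg w I * avg (\<lambda>x. inverse (w x)) I \<le> A2_const w"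
    unfolding A2_const_def by (rule SUP_upper[OF assms(2)])
  then have "?a / ennreal v * (?s / ennreal v) \<le> A2_const w"
    by (simp only: avg_def abs_w v(2))
  then have "?a / ennreal v * (?s / ennreal v) * ennreal (v\<^sup>2) \<le> A2_const w * ennreal (v\<^sup>2)"
    by (rule mult_right_mono) simp
  also have "?a / ennreal v * (?s / ennreal v) * ennreal (v\<^sup>2) =
      ?a * ?s * ((inverse (ennreal v) * ennreal v) * (inverse (ennreal v) * ennreal v))"
    using v(1) by (simp add: divide_ennreal_def power2_eq_square ennreal_mult mult_ac)
  also have "inverse (ennreal v) * ennreal v = 1"
    using v(1) by (simp add: inverse_ennreal flip: ennreal_mult)
  finally show le: "?a * ?s \<le> A2_const w * ennreal ((measure lebesgue I)\<^sup>2)"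
    by (simp add: v_def)
  have "0 < ?s" by (rule weight_set_integral_pos[OF w(2) assms(2)])
  moreover have "A2_const w * ennreal ((measure lebesgue I)\<^sup>2) < \<infinity>"
    using w(3) by (simp add: ennreal_mult_less_top)
  with le have "?a * ?s < \<infinity>" by (rule order_le_less_trans)
  ultimately show "?a < \<infinity>"
    by (auto simp: ennreal_mult_less_top)
qed

text \<open>Real values make the differences of the Hardy inequalities genuine. For A2 weights the
  integral is finite, so \<open>enn2real\<close> does not fall back to its value 0 at
  infinity.\<close>

definition ball_mass :: "(real \<Rightarrow> real) \<Rightarrow> real \<Rightarrow> int \<Rightarrow> real" where
  "ball_mass w c k = enn2real (\<integral>\<^sup>+x\<in>cent_ball c k. ennreal (w x) \<partial>lebesgue)"

lemma measure_cent_ball: "measure lebesgue (cent_ball c k) = 2 * 2 powr real_of_int k"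
  by (simp add: cent_ball_def)

lemma emeasure_annulus: "emeasure lebesgue (annulus c k) = ennreal (2 powr real_of_int k)"
proof -
  have "emeasure lebesgue (annulus c k) =
      emeasure lebesgue (cent_ball c k) - emeasure lebesgue (cent_ball c (k - 1))"
    unfolding annulus_def
    by (rule emeasure_Diff) (auto simp: cent_ball_mono, auto simp: cent_ball_def)
  also have "\<dots> = ennreal (2 * 2 powr real_of_int k - 2 * 2 powr real_of_int (k - 1))"
    by (simp add: cent_ball_def ennreal_minus)
  finally show ?thesis by (simp add: powr_diff)
qed

lemma ball_mass_eq:
  assumes "A2_weight w"
  shows "(\<integral>\<^sup>+x\<in>cent_ball c k. ennreal (w x) \<partial>lebesgue) = ennreal (ball_mass w c k)"
  using A2_interval(2)[OF assms cent_ball_in_intervals[of c k]]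
  by (simp add: ball_mass_def ennreal_enn2real)

lemma ball_mass_pos:
  assumes "A2_weight w"
  shows "0 < ball_mass w c k"
proof -
  have "0 < ennreal (ball_mass w c k)"
    using weight_set_integral_pos[OF _ cent_ball_in_intervals[of c k], of w] assms
    by (simp add: A2_weight_def flip: ball_mass_eq[OF assms])
  then show ?thesis by simp
qed

lemma annulus_mass_eq:
  assumes "A2_weight w"
  shows "(\<integral>\<^sup>+x\<in>annulus c k. ennreal (w x) \<partial>lebesgue) = ennreal (ball_mass w c k - ball_mass w c (k - 1))"
    (is "?a = _")
proof -
  have [measurable]: "w \<in> borel_measurable lebesgue"
    using assms by (simp add: A2_weight_def weight_def)
  have "ennreal (ball_mass w c k) =
      (\<integral>\<^sup>+x. ennreal (w x) * indicator (annulus c k) x + ennreal (w x) * indicator (cent_ball c (k - 1)) x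
        \<partial>lebesgue)"
    unfolding ball_mass_eq[OF assms, symmetric] annulus_def
    using cent_ball_mono[of "k - 1" k c]
    by (intro nn_integral_cong) (auto split: split_indicator)
  also have "\<dots> = ?a + ennreal (ball_mass w c (k - 1))"
    by (subst nn_integral_add) (auto simp: ball_mass_eq[OF assms])
  finally have *: "ennreal (ball_mass w c k) = ?a + ennreal (ball_mass w c (k - 1))" .
  \<comment> \<open>Cancellation in \<open>ennreal\<close> is legitimate because the subtracted mass
    is finite.\<close>
  have "?a = ?a + ennreal (ball_mass w c (k - 1)) - ennreal (ball_mass w c (k - 1))"
    by simp
  also have "\<dots> = ennreal (ball_mass w c k - ball_mass w c (k - 1))"
    using ball_mass_pos[OF assms, of c "k - 1"] by (simp add: ennreal_minus flip: *)
  finally show ?thesis .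
qed

lemma ball_mass_mono:
  assumes "A2_weight w"
  shows "ball_mass w c (k - 1) \<le> ball_mass w c k"
proof -
  have "ennreal (ball_mass w c (k - 1)) \<le> ennreal (ball_mass w c k)"
    unfolding ball_mass_eq[OF assms, symmetric]
    using cent_ball_mono[of "k - 1" k c]
    by (intro nn_integral_mono) (auto split: split_indicator)
  then show ?thesis using ball_mass_pos[OF assms] by (simp add: less_imp_le)
qed

text \<open>The factor 4 is the square of the 2 in the length 2 * 2^k of the ball.\<close>

lemma ball_mass_A2:
  assumes "A2_weight w"
  shows "ball_mass w c k * ball_mass (\<lambda>x. inverse (w x)) c k \<le>
    4 * enn2real (A2_const w) * (2 powr real_of_int k)\<^sup>2"
proof -
  let ?s = "\<lambda>x. inverse (w x)"
  have A2': "A2_weight ?s" by (rule A2_weight_inverse[OF assms])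
  have Q: "A2_const w = ennreal (enn2real (A2_const w))"
    using assms by (simp add: A2_weight_def ennreal_enn2real)
  have "ennreal (ball_mass w c k) * ennreal (ball_mass ?s c k) \<le>
      ennreal (enn2real (A2_const w)) * ennreal ((2 * 2 powr real_of_int k)\<^sup>2)"
    using A2_interval(1)[OF assms cent_ball_in_intervals[of c k]]
    unfolding ball_mass_eq[OF assms] ball_mass_eq[OF A2'] measure_cent_ball Q[symmetric] .
  then have "ennreal (ball_mass w c k * ball_mass ?s c k) \<le>
      ennreal (enn2real (A2_const w) * (2 * 2 powr real_of_int k)\<^sup>2)"
    using ball_mass_pos[OF assms, of c k] by (simp add: ennreal_mult')
  then have "ball_mass w c k * ball_mass ?s c k \<le>
      enn2real (A2_const w) * (2 * 2 powr real_of_int k)\<^sup>2"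
    by (subst (asm) ennreal_le_iff) auto
  then show ?thesis by (simp add: power_mult_distrib mult_ac)
qed

text \<open>The weighted inequality with p = 1/w on the annulus, applied to g w. It links the
  integral of g to the dual mass and the weighted square.\<close>

lemma annulus_Cauchy_Schwarz:
  assumes w: "weight w" and [measurable]: "g \<in> borel_measurable lebesgue"
  shows "(\<integral>\<^sup>+x\<in>annulus c k. g x \<partial>lebesgue)\<^sup>2 \<le>
    (\<integral>\<^sup>+x\<in>annulus c k. ennreal (inverse (w x)) \<partial>lebesgue) *
    (\<integral>\<^sup>+x\<in>annulus c k. (g x)\<^sup>2 * ennreal (w x) \<partial>lebesgue)"
proof -
  have [measurable]: "w \<in> borel_measurable lebesgue" and w_pos: "\<And>x. 0 < w x"
    using w by (auto simp: weight_def)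
  let ?D = "annulus c k"
  let ?p = "\<lambda>x. inverse (w x) * indicator ?D x" and ?h = "\<lambda>x. g x * ennreal (w x)"
  have ww: "ennreal (inverse (w x)) * ennreal (w x) = 1" for x
    using w_pos[of x] by (simp flip: ennreal_mult)
  have 1: "ennreal (?p x) * ?h x = g x * indicator ?D x" for x
    using ww[of x] by (auto simp: mult.left_commute split: split_indicator)
  have 2: "ennreal (?p x) * (?h x)\<^sup>2 = (g x)\<^sup>2 * ennreal (w x) * indicator ?D x" for x
  proof -
    have "ennreal (inverse (w x)) * (?h x)\<^sup>2 =
        (g x)\<^sup>2 * ennreal (w x) * (ennreal (inverse (w x)) * ennreal (w x))"
      by (simp only: power2_eq_square mult_ac)
    then show ?thesis by (auto simp: ww split: split_indicator)
  qed
  have 3: "ennreal (?p x) = ennreal (inverse (w x)) * indicator ?D x" for x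
    by (auto split: split_indicator)
  have "(\<integral>\<^sup>+x. ennreal (?p x) * ?h x \<partial>lebesgue)\<^sup>2 \<le>
      (\<integral>\<^sup>+x. ennreal (?p x) \<partial>lebesgue) * (\<integral>\<^sup>+x. ennreal (?p x) * (?h x)\<^sup>2 \<partial>lebesgue)"
    by (rule weighted_Cauchy_Schwarz_nn_integral) (use w_pos in \<open>auto simp: less_imp_le\<close>)
  then show ?thesis by (simp only: 1 2) (simp only: 3)
qed

text \<open>The annulus has measure exactly 2^k, so Cauchy-Schwarz for g = 1 bounds 4^k by the
  product of its masses under w and 1/w. The A2 condition on the ball bounds the product of the ball
  masses by 4 [w] 4^k; comparing the two and cancelling the dual ball mass leaves the claim.\<close>

lemma reverse_doubling_ball_mass:
  assumes "A2_weight w"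
  shows "reverse_doubling (ball_mass w c) (4 * enn2real (A2_const w))"
proof
  let ?s = "\<lambda>x. inverse (w x)" and ?Q = "enn2real (A2_const w)"
  have A2': "A2_weight ?s" by (rule A2_weight_inverse[OF assms])
  have [measurable]: "w \<in> borel_measurable lebesgue" and w_pos: "\<And>x. 0 < w x"
    using assms by (auto simp: A2_weight_def weight_def)
  show pos: "0 < ball_mass w c k" for k by (rule ball_mass_pos[OF assms])
  have s_pos: "0 < ball_mass ?s c k" for k by (rule ball_mass_pos[OF A2'])
  \<comment> \<open>Positivity is read off from the A2 inequality at a single scale, since both
    masses there are positive.\<close>
  show Q: "0 < 4 * ?Q"
  proof -
    have "0 < 4 * ?Q * (2 powr real_of_int 0)\<^sup>2"
      using ball_mass_A2[OF assms, of c 0] pos[of 0] s_pos[of 0]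
      by (meson mult_pos_pos order_less_le_trans)
    then show ?thesis by simp
  qed
  fix k
  let ?d = "ball_mass w c k - ball_mass w c (k - 1)"
  let ?ds = "ball_mass ?s c k - ball_mass ?s c (k - 1)"
  have d: "0 \<le> ?d" "0 \<le> ?ds" using ball_mass_mono[OF assms] ball_mass_mono[OF A2'] by auto
  have "ennreal (w x) * ennreal (w x) * ennreal (inverse (w x)) = ennreal (w x)" for x
    using w_pos[of x] by (simp flip: ennreal_mult)
  then have "(\<integral>\<^sup>+x\<in>annulus c k. 1 \<partial>lebesgue)\<^sup>2 \<le>
      (\<integral>\<^sup>+x\<in>annulus c k. ennreal (inverse (w x)) \<partial>lebesgue) *
      (\<integral>\<^sup>+x\<in>annulus c k. 1\<^sup>2 * ennreal (w x) \<partial>lebesgue)"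
    using assms by (intro annulus_Cauchy_Schwarz) (auto simp: A2_weight_def)
  then have "(ennreal (2 powr real_of_int k))\<^sup>2 \<le> ennreal ?ds * ennreal ?d"
    by (simp add: annulus_mass_eq[OF assms] annulus_mass_eq[OF A2'] emeasure_annulus)
  then have "ennreal ((2 powr real_of_int k)\<^sup>2) \<le> ennreal (?ds * ?d)"
    using d by (simp add: ennreal_mult ennreal_power)
  then have "(2 powr real_of_int k)\<^sup>2 \<le> ?ds * ?d"
    using d by (subst (asm) ennreal_le_iff) auto
  \<comment> \<open>Only the dual factor is enlarged to the ball, so that it can cancel; the factor
    of w has to remain on the annulus.\<close>
  also have "\<dots> \<le> ball_mass ?s c k * ?d"
    using d s_pos[of "k - 1"] by (intro mult_right_mono) auto
  finally have "4 * ?Q * (2 powr real_of_int k)\<^sup>2 \<le> 4 * ?Q * (ball_mass ?s c k * ?d)"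
    using Q by (intro mult_left_mono) auto
  then have "ball_mass w c k * ball_mass ?s c k \<le> 4 * ?Q * ?d * ball_mass ?s c k"
    using ball_mass_A2[OF assms, of c k] by (simp add: mult_ac)
  then show "ball_mass w c k \<le> 4 * ?Q * ?d"
    using s_pos[of k] by simp
qed

section \<open>The weighted estimate and the operator norm\<close>

lemma strong_sparse_weighted_bound:
  assumes \<gamma>: "0 < \<gamma>" and \<S>: "sparse_family \<gamma> \<S>" "\<forall>A\<in>\<S>. \<forall>B\<in>\<S>. A \<subseteq> B \<or> B \<subseteq> A"
    and w: "A2_weight w" and f [measurable]: "f \<in> borel_measurable lebesgue"
  shows "(\<integral>\<^sup>+x. (strong_sparse \<S> f x)\<^sup>2 * ennreal (w x) \<partial>lebesgue) \<le>
    ennreal ((8 / \<gamma>)\<^sup>2 * (48 * (4 * enn2real (A2_const w)) ^ 3)) *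
    (\<integral>\<^sup>+x. (ennreal \<bar>f x\<bar>)\<^sup>2 * ennreal (w x) \<partial>lebesgue)"
proof -
  have [measurable]: "w \<in> borel_measurable lebesgue" and ww: "weight w"
    using w by (auto simp: A2_weight_def weight_def)
  let ?s = "\<lambda>x. inverse (w x)" and ?L = "4 * enn2real (A2_const w)"
  obtain c where c: "\<And>A. A \<in> \<S> \<Longrightarrow> c \<in> closure A"
    using \<S> chain_of_intervals_center[of \<S>] unfolding sparse_family_def by metis
  define b where "b j = (SUP m\<in>{j..}. ennreal (2 powr - real_of_int m) *
    (\<integral>\<^sup>+i\<in>{..m}. (\<integral>\<^sup>+x\<in>annulus c i. ennreal \<bar>f x\<bar> \<partial>lebesgue) \<partial>count_space UNIV))" for j
  let ?B = "\<lambda>k. (\<integral>\<^sup>+j\<in>{k..}. b j \<partial>count_space UNIV)\<^sup>2"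
  let ?W = "ball_mass w c"
  have "(\<integral>\<^sup>+x. (strong_sparse \<S> f x)\<^sup>2 * ennreal (w x) \<partial>lebesgue) \<le>
      (\<integral>\<^sup>+k. ennreal ((8 / \<gamma>)\<^sup>2) * ?B k *
        (\<integral>\<^sup>+x\<in>annulus c k. ennreal (w x) \<partial>lebesgue) \<partial>count_space UNIV)"
  proof (rule nn_integral_le_annuli)
    fix x k assume "x \<in> annulus c k"
    then have "strong_sparse \<S> f x \<le> ennreal (8 / \<gamma>) * (\<integral>\<^sup>+j\<in>{k..}. b j \<partial>count_space UNIV)"
      unfolding b_def by (intro strong_sparse_le[OF \<gamma> \<S>(1)] c f)
    then have "(strong_sparse \<S> f x)\<^sup>2 \<le> (ennreal (8 / \<gamma>) * (\<integral>\<^sup>+j\<in>{k..}. b j \<partial>count_space UNIV))\<^sup>2"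
      by (rule power_mono) simp
    also have "\<dots> = ennreal ((8 / \<gamma>)\<^sup>2) * ?B k"
      using \<gamma> by (simp add: power_mult_distrib ennreal_power)
    finally show "(strong_sparse \<S> f x)\<^sup>2 * ennreal (w x) \<le> ennreal ((8 / \<gamma>)\<^sup>2) * ?B k * ennreal (w x)"
      by (rule mult_right_mono) simp
  qed simp
  also have "\<dots> = ennreal ((8 / \<gamma>)\<^sup>2) *
      (\<integral>\<^sup>+k. ennreal (?W k - ?W (k - 1)) * ?B k \<partial>count_space UNIV)"
    by (simp add: annulus_mass_eq[OF w] mult.assoc nn_integral_cmult)
      (simp add: mult.commute)
  \<comment> \<open>The discrete estimate is applied with f(i) the integral of |f| and x(i) the
    integral of |f|^2 w over the i-th annulus. Since [1/w] = [w], the same L serves both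
    weights.\<close>
  also have "\<dots> \<le> ennreal ((8 / \<gamma>)\<^sup>2) * (ennreal (48 * ?L ^ 3) *
      (\<integral>\<^sup>+i. (\<integral>\<^sup>+x\<in>annulus c i. (ennreal \<bar>f x\<bar>)\<^sup>2 * ennreal (w x) \<partial>lebesgue) \<partial>count_space UNIV))"
    unfolding b_def
  proof (intro mult_left_mono discrete_strong_sparse_bound)
    show "reverse_doubling (ball_mass w c) ?L" by (rule reverse_doubling_ball_mass[OF w])
    show "reverse_doubling (ball_mass ?s c) ?L"
      using reverse_doubling_ball_mass[OF A2_weight_inverse[OF w], of c]
      by (simp only: A2_const_inverse)
    show "ball_mass w c k * ball_mass ?s c k \<le> ?L * (2 powr real_of_int k)\<^sup>2" for k
      by (rule ball_mass_A2[OF w])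
    show "(\<integral>\<^sup>+x\<in>annulus c i. ennreal \<bar>f x\<bar> \<partial>lebesgue)\<^sup>2 \<le>
        ennreal (ball_mass ?s c i - ball_mass ?s c (i - 1)) *
        (\<integral>\<^sup>+x\<in>annulus c i. (ennreal \<bar>f x\<bar>)\<^sup>2 * ennreal (w x) \<partial>lebesgue)" for i
      unfolding annulus_mass_eq[OF A2_weight_inverse[OF w], symmetric]
      by (rule annulus_Cauchy_Schwarz[OF ww]) simp
  qed simp
  also have "(\<integral>\<^sup>+i. (\<integral>\<^sup>+x\<in>annulus c i. (ennreal \<bar>f x\<bar>)\<^sup>2 * ennreal (w x) \<partial>lebesgue) \<partial>count_space UNIV) =
      (\<integral>\<^sup>+x. (ennreal \<bar>f x\<bar>)\<^sup>2 * ennreal (w x) \<partial>lebesgue)"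
    by (rule nn_integral_annuli) simp
  finally show ?thesis
    by (simp only: ennreal_mult'[OF zero_le_power2] mult.assoc)
qed

lemma ennreal_power_half_le:
  assumes "a \<le> ennreal (c\<^sup>2 * q ^ 3) * x" "0 \<le> c" "0 \<le> q" "x < \<infinity>"
  shows "ennreal_power a (1/2) \<le> ennreal c * ennreal_power (ennreal q) (3/2) * ennreal_power x (1/2)"
proof -
  obtain r where r: "x = ennreal r" "0 \<le> r" using assms(4) by (cases x) auto
  have a_le: "a \<le> ennreal (c\<^sup>2 * q ^ 3 * r)"
    using assms r by (simp add: ennreal_mult)
  then obtain s where s: "a = ennreal s" "0 \<le> s" by (cases a) (auto simp: top_unique)
  have "s \<le> c\<^sup>2 * q ^ 3 * r"
    using a_le s assms r by (simp add: ennreal_le_iff)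
  then have "s powr (1/2) \<le> (c\<^sup>2 * q ^ 3 * r) powr (1/2)"
    using s by (intro powr_mono2) auto
  also have "\<dots> = c * q powr (3/2) * r powr (1/2)"
  proof -
    have "(q ^ 3) powr (1/2) = q powr (3/2)"
      using powr_powr[of q 3 "1/2"] assms(3) by simp
    moreover have "(c\<^sup>2) powr (1/2) = c"
      using assms(2) by (simp add: powr_half_sqrt)
    ultimately show ?thesis
      using assms r by (simp add: powr_mult)
  qed
  finally have "ennreal (s powr (1/2)) \<le> ennreal (c * q powr (3/2) * r powr (1/2))"
    by (rule ennreal_leI)
  then show ?thesis
    using assms r s by (simp add: ennreal_power_def ennreal_mult)
qed

theorem theorem3:
  fixes \<gamma> :: real
  assumes "0 < \<gamma>" and "\<gamma> < 1"
  shows "\<exists>C::real. C > 0 \<and>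
    (\<forall>\<S> w. sparse_family \<gamma> \<S> \<longrightarrow> (\<forall>A\<in>\<S>. \<forall>B\<in>\<S>. A \<subseteq> B \<or> B \<subseteq> A) \<longrightarrow> A2_weight w \<longrightarrow>
      L2_opnorm w (strong_sparse \<S>) \<le> ennreal C * ennreal_power (A2_const w) (3/2))"
proof (intro exI conjI allI impI)
  \<comment> \<open>Here 3072 = 48 * 4^3, with 4^3 coming from L = 4 [w].\<close>
  let ?C = "8 / \<gamma> * sqrt 3072"
  show "0 < ?C" using assms by simp
  fix \<S> w
  assume \<S>: "sparse_family \<gamma> \<S>" "\<forall>A\<in>\<S>. \<forall>B\<in>\<S>. A \<subseteq> B \<or> B \<subseteq> A" and w: "A2_weight w"
  let ?Q = "enn2real (A2_const w)"
  have Q: "A2_const w = ennreal ?Q"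
    using w by (simp add: A2_weight_def ennreal_enn2real)
  show "L2_opnorm w (strong_sparse \<S>) \<le> ennreal ?C * ennreal_power (A2_const w) (3/2)"
    unfolding L2_opnorm_def
  proof (rule SUP_least)
    fix f assume "f \<in> {f \<in> L2_w w. L2_wnorm w (\<lambda>x. ennreal \<bar>f x\<bar>) \<noteq> 0}"
    then have f: "f \<in> borel_measurable lebesgue" "L2_wnorm w (\<lambda>x. ennreal \<bar>f x\<bar>) < \<infinity>"
      "L2_wnorm w (\<lambda>x. ennreal \<bar>f x\<bar>) \<noteq> 0"
      by (auto simp: L2_w_def)
    \<comment> \<open>An infinite integral would have infinite norm, since
      \<open>ennreal_power\<close> sends infinity to infinity.\<close>
    have fin: "(\<integral>\<^sup>+x. (ennreal \<bar>f x\<bar>)\<^sup>2 * ennreal (w x) \<partial>lebesgue) < \<infinity>"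
      using f(2) by (auto simp: L2_wnorm_def ennreal_power_def top.not_eq_extremum split: if_splits)
    have C: "?C\<^sup>2 * ?Q ^ 3 = (8 / \<gamma>)\<^sup>2 * (48 * (4 * ?Q) ^ 3)"
      by (simp add: power_mult_distrib power_divide)
    have "L2_wnorm w (strong_sparse \<S> f) \<le>
        ennreal ?C * ennreal_power (ennreal ?Q) (3/2) * L2_wnorm w (\<lambda>x. ennreal \<bar>f x\<bar>)"
      unfolding L2_wnorm_def
      using strong_sparse_weighted_bound[OF assms(1) \<S> w f(1)] assms(1)
      by (intro ennreal_power_half_le fin) (simp_all only: C, simp_all)
    then show "L2_wnorm w (strong_sparse \<S> f) / L2_wnorm w (\<lambda>x. ennreal \<bar>f x\<bar>) \<le>
        ennreal ?C * ennreal_power (A2_const w) (3/2)"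
      using f(2,3) Q by (intro divide_le_posI_ennreal) (auto simp: zero_less_iff_neq_zero mult_ac)
  qed
qed

end
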